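(* The poset species $\Pi_2:S\mapsto\Pi_2(S)$ of non-crossing $2$-partitions, equipped with the morphism of poset species $a:\Pi_2\to\Pi$, $a(\pi,\rho,f)=\pi$, and with the morphisms $\varphi_{(\pi,\rho,f)}$ and $\psi_{(\pi,\rho,f)}$ described in the context, is an operadic poset species.
   Context: All finite sets $S$ are non-empty. $\Pi(S)$ is the poset of partitions of $S$, with $\alpha\le\beta$ iff $\alpha$ is obtained by merging blocks of $\beta$. For $T\subset S$, $\pi_{|T}$ is the set of blocks of $\pi$ contained in $T$. There are isomorphisms $\varphi_\pi:\Pi_{\le\pi}(S)\to\Pi(\pi)$, $\alpha\mapsto\{\pi_{|T},T\in\alpha\}$, and $\psi_\pi:\Pi_{\ge\pi}(S)\to\prod_{T\in\pi}\Pi(T)$, $\beta\mapsto(\beta_{|T})_{T\in\pi}$ (a partition is identified with its set of blocks). Non-crossing 2-partitions. A partition of $\{1,\dots,n\}$ is non-crossing if for any $i<j<k<l$, if $i,k$ are in the same block and $j,l$ are in the same block, then the four elements are in the same block. A non-crossing $2$-partition of $S$ is a triple $(\pi,\rho,f)$ where $\pi$ is a partition of $S$, $\rho$ is a non-crossing partition of $\{1,\dots,|S|\}$, and $f:\pi\to\rho$ is a bijection between the sets of blocks with $|f(T)|=|T|$ for all $T\in\pi$. $\Pi_2(S)$ is the set of those, with $(\pi,\rho,f)\le(\pi',\rho',f')$ iff $\pi\le\pi'$, $\rho\le\rho'$, and for all $T\in\pi$, $T'\in\pi'$, $T'\subset T\Rightarrow f'(T')\subset f(T)$. The morphism $\psi_{(\pi,\rho,f)}:(\Pi_2)_{\ge(\pi,\rho,f)}(S)\to\prod_{T\in\pi}\Pi_2(T)$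 sends $(\beta,\mu,g)$ to $(\beta_{|T},\mu_{|f(T)},g_{|T})_{T\in\pi}$, where $g_{|T}:\beta_{|T}\to\mu_{|f(T)}$ is the restriction of $g$ and $\mu_{|f(T)}$ is viewed as a partition of $\{1,\dots,|T|\}$ via the increasing bijection $f(T)\simeq\{1,\dots,|T|\}$. For non-crossing partitions $\mu\le\rho$ of $\{1,\dots,n\}$, view $\varphi_\rho(\mu)\in\Pi(\rho)$ as a (non-crossing) partition of $\{1,\dots,|\rho|\}$ via the bijection $\sigma_\rho:\rho\to\{1,\dots,|\rho|\}$ which orders the blocks of $\rho$ by their minimal elements. The morphism $\varphi_{(\pi,\rho,f)}:(\Pi_2)_{\le(\pi,\rho,f)}(S)\to\Pi_2(\pi)$ sends $(\alpha,\mu,g)$ to $(\varphi_\pi(\alpha),\varphi_\rho(\mu),g)$, where $g$ also denotes the bijection $\varphi_\pi(\alpha)\to\varphi_\rho(\mu)$ induced by $g:\alpha\to\mu$ and the bijections $\alpha\simeq\varphi_\pi(\alpha)$, $\mu\simeq\varphi_\rho(\mu)$. Operadic poset species. A poset species is a functor from finite sets and bijections to (finite) posets. An operadic poset species is a poset species $P$ with a morphism of poset species $a:P\to\Pi$ such that $a^{-1}(\min\Pi(S))=\min P(S)$ and $a^{-1}(\max\Pi(S))=\max P(S)$ for all $S$ (sets of minimal/maximal elements), and, for all $S$ and $x\in P(S)$ with $a(x)=\pi$, morphisms of posets $\varphi_x:P_{\le x}(S)\to P(\pi)$ and $\psi_x:P_{\ge x}(S)\to\prod_{T\in\pi}P(T)$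 with $a\circ\varphi_x=\varphi_\pi\circ a$ and $a\circ\psi_x=\psi_\pi\circ a$, satisfying: (Equivariance) For a bijection $u:S\to S'$, $x\in P(S)$, $x'=P(u)(x)$, $\pi=a(x)$, $\pi'=a(x')$, and the induced bijections $u:\pi\to\pi'$, $u_{|T}:T\to u(T)$: $P(u)\circ\varphi_x=\varphi_{x'}\circ P(u)$ and $(P(u_{|T}))_{T\in\pi}\circ\psi_x=\psi_{x'}\circ P(u)$. (Unitality) $P(\{s\})$ is a singleton for every singleton $\{s\}$. (Associativity) Let $x\le x'$ in $P(S)$, $\pi=a(x)$, $\pi'=a(x')$, $\underline{x}=\varphi_{x'}(x)\in P(\pi')$, $(x'_{|T})_{T\in\pi}=\psi_x(x')$; identify $\pi$ with the partition $\{\pi'_{|T},T\in\pi\}$ of $\pi'$. Then $\varphi_{\underline{x}}\circ\varphi_{x'}=\varphi_x$ on $P_{\le x}(S)$; $(\psi_{x'_{|T}})_{T\in\pi}\circ\psi_x=\psi_{x'}$ on $P_{\ge x'}(S)$; and $\psi_{\underline{x}}\circ\varphi_{x'}=(\varphi_{x'_{|T}})_{T\in\pi}\circ\psi_x$ as maps $P_{[x,x']}(S)\to\prod_{T\in\pi}P(\pi'_{|T})$. *)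

theory Defs
  imports Main "HOL-Library.FSet" "HOL-Library.FuncSet" "HOL-Library.Disjoint_Sets"
begin

section \<open>A universe of finite sets\<close>

text \<open>
  A species is evaluated on a finite set, on the set of blocks of a partition of it, on the set of
  blocks of a partition of that, and so on.  To have all these sets in one HOL type, finite sets are
  taken to be finite sets of elements of the following universe: hereditarily finite sets over an
  arbitrary type of atoms.  Every finite set occurs in it via \<open>Atom\<close>, and every finite set \<open>T\<close> of
  elements of the universe is itself an element \<open>obj T\<close>.
\<close>

datatype 'a hfs = Atom 'a | HSet "'a hfs fset"

definition obj :: "'a hfs set \<Rightarrow> 'a hfs" where
  "obj T = HSet (Abs_fset T)"

primrec elts :: "'a hfs \<Rightarrow> 'a hfs set" where
  "elts (Atom a) = {}"
| "elts (HSet A) = fset A"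

lemma elts_obj [simp]: "finite T \<Longrightarrow> elts (obj T) = T"
  by (simp add: obj_def Abs_fset_inverse)

text \<open>The set of blocks of \<open>\<pi>\<close>, as a set on which species can be evaluated.\<close>

definition blks :: "'a hfs set set \<Rightarrow> 'a hfs set" where
  "blks \<pi> = obj ` \<pi>"

text \<open>By convention the finite sets on which species are evaluated are non-empty.\<close>

definition fin_set :: "'a set \<Rightarrow> bool" where
  "fin_set S \<longleftrightarrow> finite S \<and> S \<noteq> {}"


section \<open>Posets\<close>

definition poset_on :: "'a set \<Rightarrow> ('a \<Rightarrow> 'a \<Rightarrow> bool) \<Rightarrow> bool" where
  "poset_on A le \<longleftrightarrow> reflp_on A le \<and> antisymp_on A le \<and> transp_on A le"

definition poset_morphism ::
  "'a set \<Rightarrow> ('a \<Rightarrow> 'a \<Rightarrow> bool) \<Rightarrow> 'b set \<Rightarrow> ('b \<Rightarrow> 'b \<Rightarrow> bool) \<Rightarrow> ('a \<Rightarrow> 'b) \<Rightarrow> bool" where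
  "poset_morphism A leA B leB f \<longleftrightarrow> f \<in> A \<rightarrow> B \<and> monotone_on A leA leB f"

definition min_elements :: "'a set \<Rightarrow> ('a \<Rightarrow> 'a \<Rightarrow> bool) \<Rightarrow> 'a set" where
  "min_elements A le = {x \<in> A. \<forall>y\<in>A. le y x \<longrightarrow> y = x}"

definition max_elements :: "'a set \<Rightarrow> ('a \<Rightarrow> 'a \<Rightarrow> bool) \<Rightarrow> 'a set" where
  "max_elements A le = {x \<in> A. \<forall>y\<in>A. le x y \<longrightarrow> y = x}"


section \<open>Partitions\<close>

definition Part :: "'a set \<Rightarrow> 'a set set set" where
  "Part S = {\<pi>. partition_on S \<pi>}"

text \<open>\<open>\<alpha> \<le> \<beta>\<close> iff \<open>\<alpha>\<close> is obtained by merging blocks of \<open>\<beta>\<close>: the order is opposite to that of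
  \<^const>\<open>refines\<close>, and the one-block partition is the least element.\<close>

definition part_le :: "'a set \<Rightarrow> 'a set set \<Rightarrow> 'a set set \<Rightarrow> bool" where
  "part_le S \<alpha> \<beta> \<longleftrightarrow> refines S \<beta> \<alpha>"

definition part_map :: "('a \<Rightarrow> 'b) \<Rightarrow> 'a set set \<Rightarrow> 'b set set" where
  "part_map u \<pi> = (\<lambda>T. u ` T) ` \<pi>"

definition restr :: "'a set set \<Rightarrow> 'a set \<Rightarrow> 'a set set" where
  "restr \<pi> T = {U \<in> \<pi>. U \<subseteq> T}"

definition part_quot :: "'a set set \<Rightarrow> 'a set set \<Rightarrow> 'a set set set" where
  "part_quot \<pi> \<alpha> = restr \<pi> ` \<alpha>"

definition part_phi :: "'a hfs set set \<Rightarrow> 'a hfs set set \<Rightarrow> 'a hfs set set" where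
  "part_phi \<pi> \<alpha> = part_map obj (part_quot \<pi> \<alpha>)"

definition part_psi :: "'a set set \<Rightarrow> 'a set set \<Rightarrow> 'a set \<Rightarrow> 'a set set" where
  "part_psi \<pi> \<beta> = (\<lambda>T\<in>\<pi>. restr \<beta> T)"

text \<open>The bijection \<open>\<pi> \<rightarrow> \<pi>'\<close>, \<open>T \<mapsto> u(T)\<close> induced by a bijection \<open>u\<close>.\<close>

definition induced :: "('a hfs \<Rightarrow> 'a hfs) \<Rightarrow> 'a hfs \<Rightarrow> 'a hfs" where
  "induced u t = obj (u ` elts t)"

text \<open>For \<open>\<pi> \<le> \<pi>'\<close>, the bijection \<open>T \<mapsto> \<pi>'\<^bsub>|T\<^esub>\<close> by which \<open>\<pi>\<close> is identified with the
  partition \<open>{\<pi>'\<^bsub>|T\<^esub>, T \<in> \<pi>}\<close> of \<open>\<pi>'\<close>.\<close>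

definition identification :: "'a hfs set set \<Rightarrow> 'a hfs \<Rightarrow> 'a hfs" where
  "identification \<pi>' t = obj (blks (restr \<pi>' (elts t)))"


section \<open>Operadic poset species\<close>

text \<open>
  \<open>P S\<close> is the value on objects, with order \<open>le S\<close>; \<open>act S u\<close> is the value of the functor on the
  bijection \<open>u\<close> with domain \<open>S\<close>.  Since \<open>u\<close> is a total HOL function, \<open>act_cong\<close> says that
  only its values on \<open>S\<close> matter.
\<close>

locale poset_species =
  fixes P :: "'a hfs set \<Rightarrow> 'p set"
    and le :: "'a hfs set \<Rightarrow> 'p \<Rightarrow> 'p \<Rightarrow> bool"
    and act :: "'a hfs set \<Rightarrow> ('a hfs \<Rightarrow> 'a hfs) \<Rightarrow> 'p \<Rightarrow> 'p"
  assumes finite_P: "fin_set S \<Longrightarrow> finite (P S)"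
    and poset_P: "fin_set S \<Longrightarrow> poset_on (P S) (le S)"
    and act_morphism: "fin_set S \<Longrightarrow> bij_betw u S S' \<Longrightarrow>
      poset_morphism (P S) (le S) (P S') (le S') (act S u)"
    and act_cong: "fin_set S \<Longrightarrow> bij_betw u S S' \<Longrightarrow> (\<And>s. s \<in> S \<Longrightarrow> u s = v s) \<Longrightarrow> x \<in> P S \<Longrightarrow>
      act S u x = act S v x"
    and act_id: "fin_set S \<Longrightarrow> x \<in> P S \<Longrightarrow> act S id x = x"
    and act_comp: "fin_set S \<Longrightarrow> bij_betw u S S' \<Longrightarrow> bij_betw v S' S'' \<Longrightarrow> x \<in> P S \<Longrightarrow>
      act S (v \<circ> u) x = act S' v (act S u x)"
begin

definition down :: "'a hfs set \<Rightarrow> 'p \<Rightarrow> 'p set" where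
  "down S x = {y \<in> P S. le S y x}"

definition up :: "'a hfs set \<Rightarrow> 'p \<Rightarrow> 'p set" where
  "up S x = {y \<in> P S. le S x y}"

definition prod_P :: "'a hfs set set \<Rightarrow> ('a hfs set \<Rightarrow> 'p) set" where
  "prod_P \<pi> = (\<Pi>\<^sub>E T\<in>\<pi>. P T)"

definition prod_le :: "'a hfs set set \<Rightarrow> ('a hfs set \<Rightarrow> 'p) \<Rightarrow> ('a hfs set \<Rightarrow> 'p) \<Rightarrow> bool" where
  "prod_le \<pi> p q \<longleftrightarrow> (\<forall>T\<in>\<pi>. le T (p T) (q T))"

end

locale operadic_poset_species = poset_species P le act
  for P :: "'a hfs set \<Rightarrow> 'p set"
    and le :: "'a hfs set \<Rightarrow> 'p \<Rightarrow> 'p \<Rightarrow> bool"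
    and act :: "'a hfs set \<Rightarrow> ('a hfs \<Rightarrow> 'a hfs) \<Rightarrow> 'p \<Rightarrow> 'p" +
  fixes a :: "'a hfs set \<Rightarrow> 'p \<Rightarrow> 'a hfs set set"
    and \<phi> :: "'a hfs set \<Rightarrow> 'p \<Rightarrow> 'p \<Rightarrow> 'p"
    and \<psi> :: "'a hfs set \<Rightarrow> 'p \<Rightarrow> 'p \<Rightarrow> 'a hfs set \<Rightarrow> 'p"
  assumes a_morphism: "fin_set S \<Longrightarrow> poset_morphism (P S) (le S) (Part S) (part_le S) (a S)"
    and a_natural: "fin_set S \<Longrightarrow> bij_betw u S S' \<Longrightarrow> x \<in> P S \<Longrightarrow>
      a S' (act S u x) = part_map u (a S x)"
    and a_min: "fin_set S \<Longrightarrow>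
      {x \<in> P S. a S x \<in> min_elements (Part S) (part_le S)} = min_elements (P S) (le S)"
    and a_max: "fin_set S \<Longrightarrow>
      {x \<in> P S. a S x \<in> max_elements (Part S) (part_le S)} = max_elements (P S) (le S)"
    and phi_morphism: "fin_set S \<Longrightarrow> x \<in> P S \<Longrightarrow> \<pi> = a S x \<Longrightarrow>
      poset_morphism (down S x) (le S) (P (blks \<pi>)) (le (blks \<pi>)) (\<phi> S x)"
    and psi_morphism: "fin_set S \<Longrightarrow> x \<in> P S \<Longrightarrow> \<pi> = a S x \<Longrightarrow>
      poset_morphism (up S x) (le S) (prod_P \<pi>) (prod_le \<pi>) (\<psi> S x)"
    and a_phi: "fin_set S \<Longrightarrow> x \<in> P S \<Longrightarrow> \<pi> = a S x \<Longrightarrow> y \<in> down S x \<Longrightarrow>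
      a (blks \<pi>) (\<phi> S x y) = part_phi \<pi> (a S y)"
    and a_psi: "fin_set S \<Longrightarrow> x \<in> P S \<Longrightarrow> \<pi> = a S x \<Longrightarrow> y \<in> up S x \<Longrightarrow> T \<in> \<pi> \<Longrightarrow>
      a T (\<psi> S x y T) = part_psi \<pi> (a S y) T"
    and equivariance_phi: "fin_set S \<Longrightarrow> bij_betw u S S' \<Longrightarrow> x \<in> P S \<Longrightarrow> x' = act S u x \<Longrightarrow>
      \<pi> = a S x \<Longrightarrow> y \<in> down S x \<Longrightarrow>
      act (blks \<pi>) (induced u) (\<phi> S x y) = \<phi> S' x' (act S u y)"
    and equivariance_psi: "fin_set S \<Longrightarrow> bij_betw u S S' \<Longrightarrow> x \<in> P S \<Longrightarrow> x' = act S u x \<Longrightarrow>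
      \<pi> = a S x \<Longrightarrow> y \<in> up S x \<Longrightarrow> T \<in> \<pi> \<Longrightarrow>
      act T u (\<psi> S x y T) = \<psi> S' x' (act S u y) (u ` T)"
    and unitality: "is_singleton (P {s})"
    and associativity_phi: "fin_set S \<Longrightarrow> x \<in> P S \<Longrightarrow> x' \<in> P S \<Longrightarrow> le S x x' \<Longrightarrow>
      \<pi> = a S x \<Longrightarrow> \<pi>' = a S x' \<Longrightarrow> y \<in> down S x \<Longrightarrow>
      \<phi> (blks \<pi>') (\<phi> S x' x) (\<phi> S x' y) = act (blks \<pi>) (identification \<pi>') (\<phi> S x y)"
    and associativity_psi: "fin_set S \<Longrightarrow> x \<in> P S \<Longrightarrow> x' \<in> P S \<Longrightarrow> le S x x' \<Longrightarrow>
      \<pi> = a S x \<Longrightarrow> \<pi>' = a S x' \<Longrightarrow> y \<in> up S x' \<Longrightarrow> T \<in> \<pi> \<Longrightarrow> U \<in> restr \<pi>' T \<Longrightarrow>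
      \<psi> T (\<psi> S x x' T) (\<psi> S x y T) U = \<psi> S x' y U"
    and associativity_phi_psi: "fin_set S \<Longrightarrow> x \<in> P S \<Longrightarrow> x' \<in> P S \<Longrightarrow> le S x x' \<Longrightarrow>
      \<pi> = a S x \<Longrightarrow> \<pi>' = a S x' \<Longrightarrow> y \<in> up S x \<inter> down S x' \<Longrightarrow> T \<in> \<pi> \<Longrightarrow>
      \<psi> (blks \<pi>') (\<phi> S x' x) (\<phi> S x' y) (blks (restr \<pi>' T)) = \<phi> T (\<psi> S x x' T) (\<psi> S x y T)"


section \<open>Non-crossing 2-partitions\<close>

definition noncrossing :: "nat \<Rightarrow> nat set set \<Rightarrow> bool" where
  "noncrossing n \<rho> \<longleftrightarrow> partition_on {1..n} \<rho> \<and>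
    (\<forall>i j k l. i < j \<and> j < k \<and> k < l \<longrightarrow>
      (\<forall>A\<in>\<rho>. \<forall>B\<in>\<rho>. i \<in> A \<and> k \<in> A \<and> j \<in> B \<and> l \<in> B \<longrightarrow> A = B))"

type_synonym 'a two_partition = "'a hfs set set \<times> nat set set \<times> ('a hfs set \<Rightarrow> nat set)"

text \<open>The condition \<open>f \<in> extensional \<pi>\<close> makes the HOL function \<open>f\<close> stand for a map with domain \<open>\<pi>\<close>.\<close>

definition NC2 :: "'a hfs set \<Rightarrow> 'a two_partition set" where
  "NC2 S = {(\<pi>, \<rho>, f). partition_on S \<pi> \<and> noncrossing (card S) \<rho> \<and>
     f \<in> extensional \<pi> \<and> bij_betw f \<pi> \<rho> \<and> (\<forall>T\<in>\<pi>. card (f T) = card T)}"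

definition NC2_le :: "'a hfs set \<Rightarrow> 'a two_partition \<Rightarrow> 'a two_partition \<Rightarrow> bool" where
  "NC2_le S = (\<lambda>(\<pi>, \<rho>, f) (\<pi>', \<rho>', f'). part_le S \<pi> \<pi>' \<and> part_le {1..card S} \<rho> \<rho>' \<and>
     (\<forall>T\<in>\<pi>. \<forall>T'\<in>\<pi>'. T' \<subseteq> T \<longrightarrow> f' T' \<subseteq> f T))"

text \<open>Transport along \<open>u\<close>: \<open>\<rho>\<close> is unchanged and \<open>f\<close> becomes \<open>u(T) \<mapsto> f(T)\<close>.\<close>

definition NC2_act ::
  "'a hfs set \<Rightarrow> ('a hfs \<Rightarrow> 'a hfs) \<Rightarrow> 'a two_partition \<Rightarrow> 'a two_partition" where
  "NC2_act S u = (\<lambda>(\<pi>, \<rho>, f).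
     (part_map u \<pi>, \<rho>, \<lambda>T'\<in>part_map u \<pi>. f (inv_into S u ` T')))"

definition NC2_a :: "'a hfs set \<Rightarrow> 'a two_partition \<Rightarrow> 'a hfs set set" where
  "NC2_a S = (\<lambda>(\<pi>, \<rho>, f). \<pi>)"

text \<open>On a finite set \<open>A\<close> of natural numbers, \<open>rank A\<close> is the increasing bijection
  \<open>A \<rightarrow> {1..card A}\<close>; on a partition \<open>\<rho>\<close>, \<open>block_rank \<rho>\<close> is the bijection
  \<open>\<rho> \<rightarrow> {1..card \<rho>}\<close> ordering the blocks by their minimal elements.\<close>

definition rank :: "nat set \<Rightarrow> nat \<Rightarrow> nat" where
  "rank A i = card {j \<in> A. j \<le> i}"

definition block_rank :: "nat set set \<Rightarrow> nat set \<Rightarrow> nat" where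
  "block_rank \<rho> B = card {C \<in> \<rho>. Min C \<le> Min B}"

definition nc_phi :: "nat set set \<Rightarrow> nat set set \<Rightarrow> nat set set" where
  "nc_phi \<rho> \<mu> = part_map (block_rank \<rho>) (part_quot \<rho> \<mu>)"

definition nc_restr :: "nat set set \<Rightarrow> nat set \<Rightarrow> nat set set" where
  "nc_restr \<mu> A = part_map (rank A) (restr \<mu> A)"

text \<open>The map of the third component is the composite
  \<open>\<phi>\<^sub>\<pi>(\<alpha>) \<simeq> \<alpha> \<rightarrow> \<mu> \<simeq> \<phi>\<^sub>\<rho>(\<mu>)\<close> with \<open>g\<close> in the middle.\<close>

definition NC2_phi ::
  "'a hfs set \<Rightarrow> 'a two_partition \<Rightarrow> 'a two_partition \<Rightarrow> 'a two_partition" where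
  "NC2_phi S = (\<lambda>(\<pi>, \<rho>, f) (\<alpha>, \<mu>, g).
     (part_phi \<pi> \<alpha>, nc_phi \<rho> \<mu>,
      \<lambda>Z\<in>part_phi \<pi> \<alpha>.
        block_rank \<rho> ` restr \<rho> (g (inv_into \<alpha> (\<lambda>T. blks (restr \<pi> T)) Z))))"

definition NC2_psi ::
  "'a hfs set \<Rightarrow> 'a two_partition \<Rightarrow> 'a two_partition \<Rightarrow> 'a hfs set \<Rightarrow> 'a two_partition" where
  "NC2_psi S = (\<lambda>(\<pi>, \<rho>, f) (\<beta>, \<mu>, g).
     \<lambda>T\<in>\<pi>. (part_psi \<pi> \<beta> T, nc_restr \<mu> (f T), \<lambda>U\<in>part_psi \<pi> \<beta> T. rank (f T) ` g U))"

end

theory Submission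
  imports Defs
begin

text \<open>
  In a non-crossing 2-partition \<open>(\<pi>, \<rho>, f)\<close> the partition \<open>\<rho>\<close> is the image of \<open>f\<close>, and in an
  inequality the refinement of the second components follows from that of the first ones and from
  the condition on the maps.  So all equalities and inequalities can be checked on \<open>\<pi>\<close> and,
  block by block, on \<open>f\<close>.  For \<open>(\<alpha>, \<mu>, g) \<le> (\<pi>, \<rho>, f)\<close> and \<open>T \<in> \<alpha>\<close>, the map \<open>f\<close> sends the blocks
  of \<open>\<pi>\<close> in \<open>T\<close> bijectively to the blocks of \<open>\<rho>\<close> in \<open>g(T)\<close>; hence \<open>\<phi>\<close> and \<open>\<psi>\<close> are well defined.
  The axioms then reduce to those for ordinary partitions and to the fact that relabelling
  by \<open>rank\<close> or \<open>block_rank\<close> preserves the order of elements, or of blocks by their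
  minima, so that iterated relabellings agree with direct ones.
\<close>

section \<open>Partitions\<close>

lemma partition_block_eq:
  assumes "partition_on S \<pi>" "A \<in> \<pi>" "B \<in> \<pi>" "x \<in> A" "x \<in> B"
  shows "A = B"
  using assms by (auto simp: partition_on_def disjoint_def)

lemma partition_block_nonempty: "partition_on S \<pi> \<Longrightarrow> A \<in> \<pi> \<Longrightarrow> A \<noteq> {}"
  by (auto simp: partition_on_def)

lemma partition_block_subset: "partition_on S \<pi> \<Longrightarrow> A \<in> \<pi> \<Longrightarrow> A \<subseteq> S"
  by (auto simp: partition_on_def)

lemma partition_block_subset_eq:
  assumes "partition_on S \<pi>" "A \<in> \<pi>" "B \<in> \<pi>" "A \<subseteq> B"
  shows "A = B"
  using assms partition_block_eq partition_block_nonempty by (metis ex_in_conv subsetD)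

text \<open>The block of \<open>\<alpha>\<close> that contains \<open>U\<close> shares
  \<open>x\<close> with \<open>T\<close>, hence equals \<open>T\<close>.\<close>

lemma refines_block_subset:
  assumes "refines S \<beta> \<alpha>" "U \<in> \<beta>" "T \<in> \<alpha>" "x \<in> U" "x \<in> T"
  shows "U \<subseteq> T"
  using assms partition_block_eq unfolding refines_def by (metis subsetD)

lemma partition_on_restr:
  "refines S \<beta> \<alpha> \<Longrightarrow> T \<in> \<alpha> \<Longrightarrow> partition_on T (restr \<beta> T)"
  unfolding restr_def by (rule refines_obtains_subset)

lemma Union_restr: "refines S \<beta> \<alpha> \<Longrightarrow> T \<in> \<alpha> \<Longrightarrow> \<Union>(restr \<beta> T) = T"
  using partition_on_restr partition_onD1 by metis

lemma restr_subset: "restr \<beta> T \<subseteq> \<beta>"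
  by (auto simp: restr_def)

lemma restr_restr: "T \<subseteq> A \<Longrightarrow> restr (restr \<beta> A) T = restr \<beta> T"
  by (auto simp: restr_def)

lemma restr_nonempty: "refines S \<beta> \<alpha> \<Longrightarrow> T \<in> \<alpha> \<Longrightarrow> restr \<beta> T \<noteq> {}"
  using Union_restr partition_block_nonempty unfolding refines_def by (metis Union_empty)

text \<open>\<open>T\<close> is recovered as the union of \<open>restr \<beta> T\<close>, so an
  inclusion of restrictions gives one of blocks.\<close>

lemma restr_subset_iff:
  assumes "refines S \<beta> \<alpha>" "refines S \<beta> \<alpha>'" "T \<in> \<alpha>" "T' \<in> \<alpha>'"
  shows "restr \<beta> T \<subseteq> restr \<beta> T' \<longleftrightarrow> T \<subseteq> T'"
proof
  assume "restr \<beta> T \<subseteq> restr \<beta> T'"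
  then show "T \<subseteq> T'" using Union_restr assms by (metis Union_mono)
qed (auto simp: restr_def)

lemma refines_restr:
  assumes "refines S \<gamma> \<beta>" "refines S \<beta> \<alpha>" "T \<in> \<alpha>"
  shows "refines T (restr \<gamma> T) (restr \<beta> T)"
  unfolding refines_def
proof (intro conjI ballI)
  show "partition_on T (restr \<gamma> T)" "partition_on T (restr \<beta> T)"
    using assms partition_on_restr refines_trans by metis+
  fix X assume X: "X \<in> restr \<gamma> T"
  then obtain Y where Y: "Y \<in> \<beta>" "X \<subseteq> Y" using assms(1) by (auto simp: refines_def restr_def)
  from X obtain x where "x \<in> X"
    using partition_block_nonempty[of S \<gamma> X] assms(1) by (auto simp: refines_def restr_def)
  \<comment> \<open>The block \<open>Y\<close> of \<open>\<beta>\<close> around \<open>X\<close>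
    meets \<open>T\<close> in \<open>x\<close>, so it cannot leave \<open>T\<close>.\<close>
  then have "Y \<subseteq> T" using refines_block_subset[OF assms(2) Y(1) assms(3)] X Y
    by (auto simp: restr_def)
  with Y show "\<exists>Y\<in>restr \<beta> T. X \<subseteq> Y" by (auto simp: restr_def)
qed

section \<open>Images of partitions under injections\<close>

lemma partition_on_part_map:
  assumes "partition_on S \<pi>" "inj_on h S"
  shows "partition_on (h ` S) (part_map h \<pi>)"
proof -
  have "{} \<notin> (`) h ` \<pi>" using assms(1) by (auto simp: partition_on_def)
  then show ?thesis using partition_on_inj_image[OF assms] by (simp add: part_map_def)
qed

lemma refines_part_map:
  assumes "refines S \<beta> \<alpha>" "inj_on h S"
  shows "refines (h ` S) (part_map h \<beta>) (part_map h \<alpha>)"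
  unfolding refines_def
proof (intro conjI ballI)
  show "partition_on (h ` S) (part_map h \<beta>)" "partition_on (h ` S) (part_map h \<alpha>)"
    using assms partition_on_part_map by (auto simp: refines_def)
  fix X assume "X \<in> part_map h \<beta>"
  then obtain U where U: "U \<in> \<beta>" "X = h ` U" by (auto simp: part_map_def)
  then obtain T where "T \<in> \<alpha>" "U \<subseteq> T" using assms(1) by (auto simp: refines_def)
  with U show "\<exists>Y\<in>part_map h \<alpha>. X \<subseteq> Y" by (auto simp: part_map_def)
qed

text \<open>Inclusion is read as the equation \<open>A \<union> B = B\<close>, which an injection
  preserves and reflects.\<close>

lemma inj_on_image_subset_iff:
  "inj_on h S \<Longrightarrow> A \<subseteq> S \<Longrightarrow> B \<subseteq> S \<Longrightarrow> h ` A \<subseteq> h ` B \<longleftrightarrow> A \<subseteq> B"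
  by (metis inj_on_image_eq_iff image_Un Un_subset_iff subset_Un_eq)

lemma inj_on_image_partition:
  assumes "partition_on S \<pi>" "inj_on h S"
  shows "inj_on ((`) h) \<pi>"
  by (intro inj_onI) (metis assms inj_on_image_eq_iff partition_block_subset)

section \<open>Quotients of a partition by a coarser one\<close>

lemma partition_on_part_quot:
  assumes "refines S \<pi> \<alpha>"
  shows "partition_on \<pi> (part_quot \<pi> \<alpha>)"
proof (rule partition_onI)
  show "\<Union>(part_quot \<pi> \<alpha>) = \<pi>"
    using assms by (auto simp: part_quot_def restr_def refines_def)
  show "{} \<notin> part_quot \<pi> \<alpha>" using restr_nonempty[OF assms] by (auto simp: part_quot_def)
  fix p q assume "p \<in> part_quot \<pi> \<alpha>" "q \<in> part_quot \<pi> \<alpha>" "p \<noteq> q"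
  then obtain P Q where PQ: "P \<in> \<alpha>" "Q \<in> \<alpha>" "p = restr \<pi> P" "q = restr \<pi> Q" "P \<noteq> Q"
    by (auto simp: part_quot_def)
  show "disjnt p q"
  proof (rule ccontr)
    assume "\<not> disjnt p q"
    then obtain X where "X \<in> p" "X \<in> q" by (auto simp: disjnt_iff)
    then have X: "X \<in> \<pi>" "X \<subseteq> P" "X \<subseteq> Q" using PQ by (auto simp: restr_def)
    \<comment> \<open>A common member \<open>X\<close> is a non-empty block inside both
      \<open>P\<close> and \<open>Q\<close>, so these blocks of \<open>\<alpha>\<close>
      meet.\<close>
    then obtain x where "x \<in> X" using partition_block_nonempty[of S \<pi> X] assms by (auto simp: refines_def)
    then show False using X PQ assms partition_block_eq unfolding refines_def by (metis subsetD)
  qed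
qed

lemma refines_part_quot:
  assumes "refines S \<pi> \<beta>" "refines S \<beta> \<alpha>"
  shows "refines \<pi> (part_quot \<pi> \<beta>) (part_quot \<pi> \<alpha>)"
  unfolding refines_def
proof (intro conjI ballI)
  show "partition_on \<pi> (part_quot \<pi> \<beta>)" "partition_on \<pi> (part_quot \<pi> \<alpha>)"
    using partition_on_part_quot refines_trans assms by metis+
  fix X assume "X \<in> part_quot \<pi> \<beta>"
  then obtain B where B: "B \<in> \<beta>" "X = restr \<pi> B" by (auto simp: part_quot_def)
  then obtain A where "A \<in> \<alpha>" "B \<subseteq> A" using assms(2) by (auto simp: refines_def)
  with B show "\<exists>Y\<in>part_quot \<pi> \<alpha>. X \<subseteq> Y" by (auto simp: part_quot_def restr_def)
qed

lemma part_map_quot: "part_map h (part_quot \<pi> \<alpha>) = (\<lambda>T. h ` restr \<pi> T) ` \<alpha>"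
  by (auto simp: part_map_def part_quot_def)

text \<open>The labelling \<open>h\<close> is kept general: it will be \<open>obj\<close> for
  partitions of \<open>S\<close> and \<open>block_rank\<close> for partitions of numbers.\<close>

lemma quot_subset_iff:
  assumes "refines S \<pi> \<alpha>" "refines S \<pi> \<alpha>'" "T \<in> \<alpha>" "T' \<in> \<alpha>'" "inj_on h \<pi>"
  shows "h ` restr \<pi> T \<subseteq> h ` restr \<pi> T' \<longleftrightarrow> T \<subseteq> T'"
  using restr_subset_iff[OF assms(1-4)] inj_on_image_subset_iff[OF assms(5) restr_subset restr_subset]
  by metis

lemma inj_on_quot:
  assumes "refines S \<pi> \<alpha>" "inj_on h \<pi>"
  shows "inj_on (\<lambda>T. h ` restr \<pi> T) \<alpha>"
  using quot_subset_iff[OF assms(1) assms(1) _ _ assms(2)] by (intro inj_onI) (metis order_refl subset_antisym)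

text \<open>By \<open>quot_subset_iff\<close>, the quotient blocks inside the image of
  \<open>A\<close> come from the \<open>T\<close> with \<open>T \<subseteq> A\<close>. This computes
  the restrictions of a quotient that occur in iterated constructions.\<close>

lemma restr_quot:
  assumes "refines S \<pi>' \<pi>" "refines S \<pi>' \<alpha>" "A \<in> \<alpha>" "inj_on h \<pi>'"
  shows "restr (part_map h (part_quot \<pi>' \<pi>)) (h ` restr \<pi>' A) = (\<lambda>T. h ` restr \<pi>' T) ` restr \<pi> A"
  using quot_subset_iff[OF assms(1,2) _ assms(3,4)]
  unfolding part_map_quot by (auto simp: restr_def[of _ "h ` _"] restr_def[of \<pi>])

lemma restr_part_map:
  assumes "partition_on S \<beta>" "T \<subseteq> S" "inj_on h S"
  shows "restr (part_map h \<beta>) (h ` T) = part_map h (restr \<beta> T)"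
  using assms inj_on_image_subset_iff[OF assms(3)] partition_block_subset[OF assms(1)]
  by (auto simp: restr_def part_map_def)

lemma obj_eq_iff: "finite A \<Longrightarrow> finite B \<Longrightarrow> obj A = obj B \<longleftrightarrow> A = B"
  by (metis elts_obj)

lemma inj_on_obj: "finite S \<Longrightarrow> partition_on S \<pi> \<Longrightarrow> inj_on obj \<pi>"
  by (intro inj_onI) (metis elts_obj partition_block_subset finite_subset)

section \<open>Ranks\<close>

lemma rank_le_iff:
  assumes "finite A" "i \<in> A" "j \<in> A"
  shows "rank A i \<le> rank A j \<longleftrightarrow> i \<le> j"
proof
  assume *: "rank A i \<le> rank A j"
  show "i \<le> j"
  proof (rule ccontr)
    assume "\<not> i \<le> j"
    then have "{k \<in> A. k \<le> j} \<subset> {k \<in> A. k \<le> i}" using assms by auto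
    then have "rank A j < rank A i" unfolding rank_def using assms by (intro psubset_card_mono) auto
    with * show False by simp
  qed
next
  assume "i \<le> j"
  then show "rank A i \<le> rank A j" unfolding rank_def using assms by (intro card_mono) auto
qed

lemma inj_on_rank: "finite A \<Longrightarrow> inj_on (rank A) A"
  by (intro inj_onI) (metis rank_le_iff order_antisym order_refl)

lemma bij_betw_rank:
  assumes "finite A" shows "bij_betw (rank A) A {1..card A}"
proof -
  have "rank A ` A \<subseteq> {1..card A}"
    using assms by (auto simp: rank_def Suc_le_eq card_gt_0_iff intro!: card_mono)
  \<comment> \<open>An injection of \<open>A\<close> into a set of \<open>card A\<close> elements is
    onto.\<close>
  then have "rank A ` A = {1..card A}"
    using assms by (intro card_subset_eq) (auto simp: card_image inj_on_rank)
  then show ?thesis using assms inj_on_rank by (auto simp: bij_betw_def)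
qed

text \<open>Ranks depend only on the order: \<open>h\<close> carries the elements counted by
  \<open>rank A j\<close> bijectively to those counted on the left.\<close>

lemma rank_image:
  assumes "\<And>i j. i \<in> A \<Longrightarrow> j \<in> A \<Longrightarrow> h i \<le> h j \<longleftrightarrow> i \<le> j" "j \<in> A"
  shows "rank (h ` A) (h j) = rank A j"
proof -
  have "inj_on h A" using assms(1) by (intro inj_onI) (metis order_antisym order_refl)
  moreover have "{i \<in> h ` A. i \<le> h j} = h ` {i \<in> A. i \<le> j}" using assms by auto
  ultimately show ?thesis unfolding rank_def
    by (metis (no_types, lifting) card_image inj_on_subset mem_Collect_eq subsetI)
qed

lemma rank_rank:
  assumes "finite A" "B \<subseteq> A" "j \<in> B"
  shows "rank (rank A ` B) (rank A j) = rank B j"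
  using assms by (intro rank_image) (auto simp: rank_le_iff subset_iff)

text \<open>An increasing relabelling sends the minimum of a set to the minimum of its
  image.\<close>

lemma rank_Min_le_iff:
  assumes "finite A" "B \<subseteq> A" "C \<subseteq> A" "B \<noteq> {}" "C \<noteq> {}"
  shows "Min (rank A ` B) \<le> Min (rank A ` C) \<longleftrightarrow> Min B \<le> Min C"
proof -
  have "Min (rank A ` X) = rank A (Min X)" if "X \<subseteq> A" "X \<noteq> {}" for X
  proof (rule Min_eqI)
    show fX: "finite (rank A ` X)" using that(1) assms(1) by (meson finite_imageI finite_subset)
    have X: "finite X" using that assms(1) finite_subset by auto
    have "Min X \<in> A" using that X Min_in by blast
    then show "rank A (Min X) \<le> y" if "y \<in> rank A ` X" for y
      using that \<open>X \<subseteq> A\<close> X rank_le_iff[OF assms(1)] by auto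
    show "rank A (Min X) \<in> rank A ` X" using X that by auto
  qed
  moreover have "Min B \<in> A" "Min C \<in> A"
    using assms by (meson Min_in finite_subset subsetD)+
  ultimately show ?thesis using assms rank_le_iff by auto
qed

section \<open>Numbering blocks by their minima\<close>

lemma inj_on_Min:
  assumes "partition_on N \<rho>" "finite N"
  shows "inj_on Min \<rho>"
  by (intro inj_onI) (metis assms partition_block_eq partition_block_nonempty partition_block_subset
      Min_in finite_subset)

text \<open>Distinct blocks have distinct minima, so counting blocks is counting minima; facts about
  \<open>rank\<close> thus transfer to \<open>block_rank\<close>.\<close>

lemma block_rank_eq_rank:
  assumes "inj_on Min \<rho>"
  shows "block_rank \<rho> B = rank (Min ` \<rho>) (Min B)"
proof -
  have "{j \<in> Min ` \<rho>. j \<le> Min B} = Min ` {C \<in> \<rho>. Min C \<le> Min B}" by auto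
  then show ?thesis unfolding block_rank_def rank_def
    by (metis (no_types, lifting) assms card_image inj_on_subset mem_Collect_eq subsetI)
qed

lemma block_rank_le_iff:
  assumes "partition_on N \<rho>" "finite N" "B \<in> \<rho>" "C \<in> \<rho>"
  shows "block_rank \<rho> B \<le> block_rank \<rho> C \<longleftrightarrow> Min B \<le> Min C"
  unfolding block_rank_eq_rank[OF inj_on_Min[OF assms(1,2)]]
  using assms finite_elements by (intro rank_le_iff) auto

lemma bij_betw_block_rank:
  assumes "partition_on N \<rho>" "finite N"
  shows "bij_betw (block_rank \<rho>) \<rho> {1..card \<rho>}"
proof -
  have inj: "inj_on Min \<rho>" using inj_on_Min assms .
  have "bij_betw (rank (Min ` \<rho>)) (Min ` \<rho>) {1..card \<rho>}"
    using bij_betw_rank[of "Min ` \<rho>"] finite_elements[OF assms(2,1)] by (simp add: card_image inj)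
  then have "bij_betw (rank (Min ` \<rho>) \<circ> Min) \<rho> {1..card \<rho>}"
    using bij_betw_trans inj_on_imp_bij_betw[OF inj] by blast
  then show ?thesis using block_rank_eq_rank[OF inj] by (auto cong: bij_betw_cong)
qed

lemma inj_on_block_rank:
  "partition_on N \<rho> \<Longrightarrow> finite N \<Longrightarrow> inj_on (block_rank \<rho>) \<rho>"
  using bij_betw_block_rank bij_betw_imp_inj_on by blast

text \<open>The block of the finer partition that contains \<open>Min D\<close> has the least rank among the
  blocks contained in \<open>D\<close>.\<close>

lemma Min_block_rank_le_iff:
  assumes "refines N \<rho>' \<rho>" "finite N" "C \<in> \<rho>" "D \<in> \<rho>"
  shows "Min (block_rank \<rho>' ` restr \<rho>' D) \<le> Min (block_rank \<rho>' ` restr \<rho>' C) \<longleftrightarrow> Min D \<le> Min C"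
proof -
  have p: "partition_on N \<rho>'" "partition_on N \<rho>" using assms by (auto simp: refines_def)
  have fin: "finite E" if "E \<in> \<rho> \<or> E \<in> \<rho>'" for E
    using that p assms(2) partition_block_subset finite_subset by metis
  have "\<exists>E\<in>\<rho>'. Min E = Min D \<and> Min (block_rank \<rho>' ` restr \<rho>' D) = block_rank \<rho>' E" if D: "D \<in> \<rho>" for D
  proof -
    have "Min D \<in> \<Union>(restr \<rho>' D)"
      using Union_restr[OF assms(1) D] Min_in fin D partition_block_nonempty p by metis
    then obtain E where E: "E \<in> restr \<rho>' D" "Min D \<in> E" by blast
    then have E': "E \<in> \<rho>'" "E \<subseteq> D" by (auto simp: restr_def)
    have le: "Min D \<le> Min F" if "F \<in> restr \<rho>' D" for F
      using that fin D partition_block_nonempty[OF p(1)]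
      by (auto simp: restr_def intro!: Min_antimono)
    have eq: "Min E = Min D" using le[OF E(1)] E fin E' by (meson Min_le order_antisym)
    have "Min (block_rank \<rho>' ` restr \<rho>' D) = block_rank \<rho>' E"
    proof (rule Min_eqI)
      have "finite \<rho>'" using finite_elements assms(2) p(1) .
      then show "finite (block_rank \<rho>' ` restr \<rho>' D)" by (simp add: restr_def)
      show "block_rank \<rho>' E \<in> block_rank \<rho>' ` restr \<rho>' D" using E by simp
      fix y assume "y \<in> block_rank \<rho>' ` restr \<rho>' D"
      then obtain F where F: "F \<in> restr \<rho>' D" "y = block_rank \<rho>' F" by auto
      then have "F \<in> \<rho>'" by (simp add: restr_def)
      then show "block_rank \<rho>' E \<le> y"
        using block_rank_le_iff[OF p(1) assms(2) E'(1), of F] le[OF F(1)] eq F by simp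
    qed
    with E' eq show ?thesis by blast
  qed
  \<comment> \<open>Both minima of ranks are ranks of single blocks of \<open>\<rho>'\<close>, whose
    minima are \<open>Min D\<close> and \<open>Min C\<close>.\<close>
  then show ?thesis using block_rank_le_iff[OF p(1) assms(2)] assms(3,4) by metis
qed

text \<open>The analogue of \<open>rank_image\<close> for blocks: an injective \<open>h\<close> that
  respects the comparison of minima matches the blocks counted on the two sides. It serves both for
  quotients and for relabelling by \<open>rank\<close>.\<close>

lemma block_rank_image:
  assumes "inj_on h \<rho>" "C \<in> \<rho>"
    "\<And>D. D \<in> \<rho> \<Longrightarrow> Min (h D) \<le> Min (h C) \<longleftrightarrow> Min D \<le> Min C"
  shows "block_rank (h ` \<rho>) (h C) = block_rank \<rho> C"
proof -
  have "{D \<in> h ` \<rho>. Min D \<le> Min (h C)} = h ` {D \<in> \<rho>. Min D \<le> Min C}" using assms by auto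
  then show ?thesis unfolding block_rank_def
    by (metis (no_types, lifting) assms(1) card_image inj_on_subset mem_Collect_eq subsetI)
qed

text \<open>Passing to the quotient keeps the order of blocks by minima, so numbering twice agrees
  with numbering once. This is the numerical content of the associativity of \<phi>.\<close>

lemma block_rank_nc_phi:
  assumes "refines N \<rho>' \<rho>" "finite N" "C \<in> \<rho>"
  shows "block_rank (nc_phi \<rho>' \<rho>) (block_rank \<rho>' ` restr \<rho>' C) = block_rank \<rho> C"
proof -
  have p: "partition_on N \<rho>'" using assms by (auto simp: refines_def)
  show ?thesis unfolding nc_phi_def part_map_quot
    using inj_on_quot[OF assms(1) inj_on_block_rank[OF p assms(2)]] assms Min_block_rank_le_iff
    by (intro block_rank_image) auto
qed

text \<open>The increasing map \<open>rank A\<close> keeps the order of minima, so the blocks inside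
  \<open>A\<close> have the same numbers before and after their elements are relabelled.\<close>

lemma block_rank_nc_restr:
  assumes "partition_on N (restr \<rho> A)" "finite A" "B \<in> restr \<rho> A"
  shows "block_rank (nc_restr \<rho> A) (rank A ` B) = block_rank (restr \<rho> A) B"
  unfolding nc_restr_def part_map_def
proof (rule block_rank_image)
  have "N \<subseteq> A" using assms(1) by (auto simp: partition_on_def restr_def)
  then show "inj_on ((`) (rank A)) (restr \<rho> A)"
    using inj_on_image_partition[OF assms(1)] inj_on_rank[OF assms(2)] inj_on_subset by blast
  show "Min (rank A ` D) \<le> Min (rank A ` B) \<longleftrightarrow> Min D \<le> Min B" if "D \<in> restr \<rho> A" for D
    using that assms(3) partition_block_nonempty[OF assms(1)]
    by (intro rank_Min_le_iff assms) (auto simp: restr_def)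
qed (rule assms)

text \<open>Both sides count the blocks of \<open>R\<close> whose minimum is at most
  \<open>Min B\<close>: numbering all blocks and then compressing the numbers used by
  \<open>R\<close> is numbering \<open>R\<close> directly.\<close>

lemma rank_block_rank:
  assumes "partition_on N \<rho>" "finite N" "R \<subseteq> \<rho>" "B \<in> R"
  shows "rank (block_rank \<rho> ` R) (block_rank \<rho> B) = block_rank R B"
proof -
  have "{j \<in> block_rank \<rho> ` R. j \<le> block_rank \<rho> B} = block_rank \<rho> ` {C \<in> R. Min C \<le> Min B}"
    using block_rank_le_iff[OF assms(1,2)] subsetD[OF assms(3)] assms(4) by blast
  moreover have "inj_on (block_rank \<rho>) {C \<in> R. Min C \<le> Min B}"
    using inj_on_block_rank[OF assms(1,2)] assms(3) by (auto intro: inj_on_subset)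
  ultimately show ?thesis unfolding rank_def block_rank_def by (simp add: card_image)
qed

section \<open>Non-crossing partitions\<close>

lemma noncrossingI:
  assumes "partition_on {1..n} \<rho>"
    "\<And>A B i j k l. A \<in> \<rho> \<Longrightarrow> B \<in> \<rho> \<Longrightarrow> i \<in> A \<Longrightarrow> k \<in> A \<Longrightarrow> j \<in> B \<Longrightarrow> l \<in> B \<Longrightarrow>
      i < j \<Longrightarrow> j < k \<Longrightarrow> k < l \<Longrightarrow> A = B"
  shows "noncrossing n \<rho>"
  unfolding noncrossing_def using assms by blast

lemma noncrossingD:
  assumes "noncrossing n \<rho>" "A \<in> \<rho>" "B \<in> \<rho>" "i \<in> A" "k \<in> A" "j \<in> B" "l \<in> B" "i < j" "j < k" "k < l"
  shows "A = B"
  using assms unfolding noncrossing_def by blast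

lemma noncrossing_partition: "noncrossing n \<rho> \<Longrightarrow> partition_on {1..n} \<rho>"
  by (simp add: noncrossing_def)

lemma noncrossing_nc_restr:
  assumes "noncrossing n \<mu>" "partition_on A (restr \<mu> A)" "finite A"
  shows "noncrossing (card A) (nc_restr \<mu> A)"
proof (rule noncrossingI)
  show "partition_on {1..card A} (nc_restr \<mu> A)"
    using partition_on_part_map[OF assms(2) inj_on_rank[OF assms(3)]] bij_betw_rank[OF assms(3)]
    by (simp add: nc_restr_def bij_betw_def)
  fix X Y i j k l
  assume *: "X \<in> nc_restr \<mu> A" "Y \<in> nc_restr \<mu> A" "i \<in> X" "k \<in> X" "j \<in> Y" "l \<in> Y" "i < j" "j < k" "k < l"
  from *(1,2) obtain X' Y' where XY: "X' \<in> \<mu>" "X' \<subseteq> A" "X = rank A ` X'" "Y' \<in> \<mu>" "Y' \<subseteq> A" "Y = rank A ` Y'"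
    by (auto simp: nc_restr_def part_map_def restr_def)
  with * obtain i' j' k' l' where e: "i' \<in> X'" "k' \<in> X'" "j' \<in> Y'" "l' \<in> Y'"
    "i = rank A i'" "k = rank A k'" "j = rank A j'" "l = rank A l'" by auto
  with XY have "i' \<in> A" "j' \<in> A" "k' \<in> A" "l' \<in> A" by auto
  \<comment> \<open>\<open>rank A\<close> reflects the order, so a crossing after relabelling comes
    from one in \<open>\<mu>\<close>.\<close>
  with e * have "i' < j'" "j' < k'" "k' < l'"
    using rank_le_iff[OF assms(3)] by (metis not_le)+
  then have "X' = Y'" using noncrossingD[OF assms(1)] XY e by metis
  with XY show "X = Y" by simp
qed

text \<open>Numbers in the quotient stand for blocks of \<open>\<rho>\<close> ordered by minima;
  replacing each number by the minimum of its block turns a crossing of the quotient into one of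
  \<open>\<mu>\<close>.\<close>

lemma noncrossing_nc_phi:
  assumes "noncrossing n \<mu>" "refines {1..n} \<rho> \<mu>"
  shows "noncrossing (card \<rho>) (nc_phi \<rho> \<mu>)"
proof (rule noncrossingI)
  have p: "partition_on {1..n} \<rho>" using assms by (simp add: refines_def)
  note b = bij_betw_block_rank[OF p, simplified]
  show "partition_on {1..card \<rho>} (nc_phi \<rho> \<mu>)"
    using partition_on_part_map[OF partition_on_part_quot[OF assms(2)], of "block_rank \<rho>"] b
    by (simp add: nc_phi_def bij_betw_def)
  fix X Y i j k l
  assume *: "X \<in> nc_phi \<rho> \<mu>" "Y \<in> nc_phi \<rho> \<mu>" "i \<in> X" "k \<in> X" "j \<in> Y" "l \<in> Y" "i < j" "j < k" "k < l"
  from *(1,2) obtain X' Y' where XY: "X' \<in> \<mu>" "X = block_rank \<rho> ` restr \<rho> X'" "Y' \<in> \<mu>" "Y = block_rank \<rho> ` restr \<rho> Y'"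
    by (auto simp: nc_phi_def part_map_quot)
  with * obtain I J K L where e: "I \<in> restr \<rho> X'" "K \<in> restr \<rho> X'" "J \<in> restr \<rho> Y'" "L \<in> restr \<rho> Y'"
    "i = block_rank \<rho> I" "k = block_rank \<rho> K" "j = block_rank \<rho> J" "l = block_rank \<rho> L" by auto
  then have e': "I \<in> \<rho>" "K \<in> \<rho>" "J \<in> \<rho>" "L \<in> \<rho>" "I \<subseteq> X'" "K \<subseteq> X'" "J \<subseteq> Y'" "L \<subseteq> Y'" by (auto simp: restr_def)
  have m: "Min E \<in> E" if "E \<in> \<rho>" for E
    using that p by (metis Min_in finite_atLeastAtMost finite_subset partition_block_nonempty partition_block_subset)
  have "Min I < Min J" "Min J < Min K" "Min K < Min L"
    using e e' * block_rank_le_iff[OF p] by (metis finite_atLeastAtMost not_le)+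
  then have "X' = Y'" using noncrossingD[OF assms(1) XY(1,3)] m e' by (meson subsetD)
  with XY show "X = Y" by simp
qed

section \<open>Non-crossing 2-partitions\<close>

abbreviation spart :: "'a two_partition \<Rightarrow> 'a hfs set set" where "spart x \<equiv> fst x"
abbreviation npart :: "'a two_partition \<Rightarrow> nat set set" where "npart x \<equiv> fst (snd x)"
abbreviation bmap :: "'a two_partition \<Rightarrow> 'a hfs set \<Rightarrow> nat set" where "bmap x \<equiv> snd (snd x)"

lemma NC2_iff:
  "x \<in> NC2 S \<longleftrightarrow> partition_on S (spart x) \<and> noncrossing (card S) (npart x) \<and>
     bmap x \<in> extensional (spart x) \<and> bij_betw (bmap x) (spart x) (npart x) \<and>
     (\<forall>T\<in>spart x. card (bmap x T) = card T)"
  by (cases x) (auto simp: NC2_def)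

lemma NC2D:
  assumes "x \<in> NC2 S"
  shows "partition_on S (spart x)" "noncrossing (card S) (npart x)"
    "partition_on {1..card S} (npart x)" "bmap x \<in> extensional (spart x)"
    "bij_betw (bmap x) (spart x) (npart x)" "bmap x ` spart x = npart x"
    "\<And>T. T \<in> spart x \<Longrightarrow> card (bmap x T) = card T"
    "\<And>T. T \<in> spart x \<Longrightarrow> bmap x T \<in> npart x"
  using assms noncrossing_partition[of "card S" "npart x"] by (auto simp: NC2_iff bij_betw_def)

lemma finite_bmap: "x \<in> NC2 S \<Longrightarrow> T \<in> spart x \<Longrightarrow> finite (bmap x T)"
  using NC2D(3,8) by (metis finite_atLeastAtMost finite_subset partition_block_subset)

text \<open>By extensionality the map is determined by its values on blocks, and
  \<open>npart\<close> is its image.\<close>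

lemma NC2_eqI:
  assumes "x \<in> NC2 S" "y \<in> NC2 S" "spart x = spart y"
    "\<And>T. T \<in> spart x \<Longrightarrow> bmap x T = bmap y T"
  shows "x = y"
proof -
  have "bmap x = bmap y"
    using assms NC2D(4) by (metis extensionalityI)
  moreover from this have "npart x = npart y"
    using assms NC2D(6) by metis
  ultimately show ?thesis using assms(3) by (simp add: prod_eq_iff)
qed

lemma NC2_le_iff:
  "NC2_le S x y \<longleftrightarrow> refines S (spart y) (spart x) \<and> refines {1..card S} (npart y) (npart x) \<and>
    (\<forall>T\<in>spart x. \<forall>U\<in>spart y. U \<subseteq> T \<longrightarrow> bmap y U \<subseteq> bmap x T)"
  by (cases x; cases y) (simp add: NC2_le_def part_le_def)

text \<open>Every block of \<open>npart y\<close> is some \<open>bmap y U\<close> and lies in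
  \<open>bmap x T\<close> for the block \<open>T\<close> containing \<open>U\<close>; this gives the
  refinement of the numerical partitions.\<close>

lemma NC2_leI:
  assumes "x \<in> NC2 S" "y \<in> NC2 S" "refines S (spart y) (spart x)"
    "\<And>T U. T \<in> spart x \<Longrightarrow> U \<in> spart y \<Longrightarrow> U \<subseteq> T \<Longrightarrow> bmap y U \<subseteq> bmap x T"
  shows "NC2_le S x y"
proof -
  have "\<exists>D\<in>npart x. C \<subseteq> D" if C: "C \<in> npart y" for C
  proof -
    obtain U where U: "U \<in> spart y" "C = bmap y U" using C NC2D(6)[OF assms(2)] by auto
    then obtain T where "T \<in> spart x" "U \<subseteq> T" using assms(3) by (auto simp: refines_def)
    then show ?thesis using U assms(4) NC2D(8)[OF assms(1)] by blast
  qed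
  then have "refines {1..card S} (npart y) (npart x)"
    using NC2D(3)[OF assms(1)] NC2D(3)[OF assms(2)] by (simp add: refines_def)
  then show ?thesis using assms by (simp add: NC2_le_iff)
qed

text \<open>Restrictions, quotients and transports of a pair \<open>y \<le> x\<close> are again such
  pairs, so interpreting the locale at them reuses its lemmas in iterated constructions.\<close>

locale NC2_interval =
  fixes S :: "'a hfs set" and y x :: "'a two_partition"
  assumes fin: "finite S" and y: "y \<in> NC2 S" and x: "x \<in> NC2 S" and le: "NC2_le S y x"
begin

lemma ref: "refines S (spart x) (spart y)"
  and ref_npart: "refines {1..card S} (npart x) (npart y)"
  and bmap_mono: "T \<in> spart y \<Longrightarrow> U \<in> spart x \<Longrightarrow> U \<subseteq> T \<Longrightarrow> bmap x U \<subseteq> bmap y T"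
  using le by (auto simp: NC2_le_iff)

text \<open>For the converse of monotonicity, \<open>U\<close> lies in some block \<open>T'\<close>,
  and the non-empty set \<open>bmap x U\<close> lies in both \<open>bmap y T\<close> and
  \<open>bmap y T'\<close>. These blocks then coincide, and injectivity of \<open>bmap y\<close>
  gives \<open>T = T'\<close>.\<close>

lemma bmap_subset_iff:
  assumes "T \<in> spart y" "U \<in> spart x"
  shows "bmap x U \<subseteq> bmap y T \<longleftrightarrow> U \<subseteq> T"
proof
  assume sub: "bmap x U \<subseteq> bmap y T"
  obtain T' where T': "T' \<in> spart y" "U \<subseteq> T'" using ref assms by (auto simp: refines_def)
  then have sub': "bmap x U \<subseteq> bmap y T'" using bmap_mono assms by blast
  obtain i where "i \<in> bmap x U"
    using partition_block_nonempty[OF NC2D(3)[OF x] NC2D(8)[OF x assms(2)]] by blast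
  then have "bmap y T = bmap y T'"
    using partition_block_eq[OF NC2D(3)[OF y] NC2D(8)[OF y assms(1)] NC2D(8)[OF y T'(1)]] sub sub' by blast
  then have "T = T'" using NC2D(5)[OF y] T' assms by (auto simp: bij_betw_def dest: inj_onD)
  with T' show "U \<subseteq> T" by simp
qed (use bmap_mono assms in blast)

text \<open>The blocks of \<open>npart x\<close> are the sets \<open>bmap x U\<close>, and
  \<open>bmap_subset_iff\<close> selects those with \<open>U \<subseteq> T\<close>. Both \<phi> and
  \<psi> rest on this correspondence.\<close>

lemma restr_npart: "T \<in> spart y \<Longrightarrow> restr (npart x) (bmap y T) = bmap x ` restr (spart x) T"
  unfolding restr_def NC2D(6)[OF x, symmetric] using bmap_subset_iff by auto

lemma bij_betw_restr:
  "T \<in> spart y \<Longrightarrow> bij_betw (bmap x) (restr (spart x) T) (restr (npart x) (bmap y T))"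
  by (rule bij_betw_subset[OF NC2D(5)[OF x] restr_subset restr_npart[symmetric]])

lemma inj_obj: "inj_on obj (spart x)"
  using inj_on_obj fin NC2D(1)[OF x] .

lemma inj_block_rank: "inj_on (block_rank (npart x)) (npart x)"
  using inj_on_block_rank NC2D(3)[OF x] by blast

lemma spart_phi: "spart (NC2_phi S x y) = (\<lambda>T. obj ` restr (spart x) T) ` spart y"
  by (cases x; cases y) (simp add: NC2_phi_def part_phi_def part_map_quot)

lemma npart_phi: "npart (NC2_phi S x y) = nc_phi (npart x) (npart y)"
  by (cases x; cases y) (simp add: NC2_phi_def)

text \<open>Removes \<open>inv_into\<close> from the definition: the quotient map on blocks is
  injective, so each block of the quotient comes from a single \<open>T\<close>.\<close>

lemma bmap_phi:
  assumes "T \<in> spart y"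
  shows "bmap (NC2_phi S x y) (obj ` restr (spart x) T) = block_rank (npart x) ` restr (npart x) (bmap y T)"
proof -
  have "inj_on (\<lambda>T. blks (restr (spart x) T)) (spart y)"
    using inj_on_quot[OF ref inj_obj] by (simp add: blks_def)
  then have "inv_into (spart y) (\<lambda>T. blks (restr (spart x) T)) (obj ` restr (spart x) T) = T"
    using assms by (metis (mono_tags, lifting) blks_def inv_into_f_f)
  moreover have "obj ` restr (spart x) T \<in> part_phi (spart x) (spart y)"
    using assms by (auto simp: part_phi_def part_map_quot)
  ultimately show ?thesis
    by (cases x; cases y) (simp add: NC2_phi_def)
qed

lemma phi_mem: "NC2_phi S x y \<in> NC2 (blks (spart x))"
proof -
  let ?h = "\<lambda>T. obj ` restr (spart x) T" and ?k = "\<lambda>C. block_rank (npart x) ` restr (npart x) C"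
  \<comment> \<open>The bijection \<open>bmap x\<close> equates the numbers of blocks, so the
    numerical quotient is a partition of the right interval.\<close>
  have c: "card (blks (spart x)) = card (npart x)"
    using card_image[OF inj_obj] bij_betw_same_card[OF NC2D(5)[OF x]] by (simp add: blks_def)
  have "partition_on (blks (spart x)) (spart (NC2_phi S x y))"
    using partition_on_part_map[OF partition_on_part_quot[OF ref] inj_obj]
    by (simp add: blks_def spart_phi part_map_quot)
  moreover have "noncrossing (card (blks (spart x))) (npart (NC2_phi S x y))"
    using noncrossing_nc_phi[OF NC2D(2)[OF y] ref_npart] by (simp add: c npart_phi)
  moreover have "bmap (NC2_phi S x y) \<in> extensional (spart (NC2_phi S x y))"
    by (cases x; cases y) (simp add: NC2_phi_def)
  moreover have "bij_betw (bmap (NC2_phi S x y)) (spart (NC2_phi S x y)) (npart (NC2_phi S x y))"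
  proof -
    have im: "bmap (NC2_phi S x y) ` ?h ` spart y = ?k ` npart y"
      using bmap_phi NC2D(6)[OF y, symmetric] by (simp add: image_image)
    have "inj_on (bmap (NC2_phi S x y)) (?h ` spart y)"
    proof (rule inj_onI, clarify)
      fix T T' assume T: "T \<in> spart y" "T' \<in> spart y"
        and "bmap (NC2_phi S x y) (?h T) = bmap (NC2_phi S x y) (?h T')"
      then have "?k (bmap y T) = ?k (bmap y T')" using bmap_phi by simp
      then have "bmap y T = bmap y T'"
        using inj_onD[OF inj_on_quot[OF ref_npart inj_block_rank]] NC2D(8)[OF y] T by blast
      then show "?h T = ?h T'" using NC2D(5)[OF y] T by (auto simp: bij_betw_def dest: inj_onD)
    qed
    then show ?thesis using im by (simp add: bij_betw_def spart_phi npart_phi nc_phi_def part_map_quot)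
  qed
  moreover have "card (bmap (NC2_phi S x y) Z) = card Z" if Z: "Z \<in> spart (NC2_phi S x y)" for Z
  proof -
    obtain T where T: "T \<in> spart y" "Z = ?h T" using Z spart_phi by auto
    \<comment> \<open>Both cardinalities count blocks: those of \<open>npart x\<close> in
      \<open>bmap y T\<close> correspond to those of \<open>spart x\<close> in \<open>T\<close>, and
      the labellings are injective.\<close>
    have "card (?k (bmap y T)) = card (restr (npart x) (bmap y T))"
      using inj_block_rank restr_subset by (intro card_image) (rule inj_on_subset)
    also have "\<dots> = card (restr (spart x) T)"
      using bij_betw_same_card[OF bij_betw_restr[OF T(1)]] by simp
    also have "\<dots> = card (?h T)"
      using inj_obj restr_subset by (intro card_image[symmetric]) (rule inj_on_subset)
    finally show ?thesis using bmap_phi T by simp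
  qed
  ultimately show ?thesis by (simp add: NC2_iff)
qed

lemma psi_eq:
  assumes "T \<in> spart y"
  shows "spart (NC2_psi S y x T) = restr (spart x) T"
    "npart (NC2_psi S y x T) = nc_restr (npart x) (bmap y T)"
    "bmap (NC2_psi S y x T) = (\<lambda>U\<in>restr (spart x) T. rank (bmap y T) ` bmap x U)"
  using assms by (cases x; cases y; simp add: NC2_psi_def part_psi_def)+

lemma partition_on_restr_npart:
  "T \<in> spart y \<Longrightarrow> partition_on (bmap y T) (restr (npart x) (bmap y T))"
  using partition_on_restr[OF ref_npart] NC2D(8)[OF y] by blast

lemma psi_mem:
  assumes T: "T \<in> spart y"
  shows "NC2_psi S y x T \<in> NC2 T"
proof -
  note p = partition_on_restr_npart[OF T] and r = inj_on_rank[OF finite_bmap[OF y T]]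
  \<comment> \<open>The equality \<open>card (bmap y T) = card T\<close> places the restriction on
    the interval required for \<open>T\<close>.\<close>
  have "noncrossing (card T) (nc_restr (npart x) (bmap y T))"
    using noncrossing_nc_restr[OF NC2D(2)[OF x] p finite_bmap[OF y T]] NC2D(7)[OF y T] by simp
  moreover have "partition_on T (restr (spart x) T)" using partition_on_restr[OF ref T] .
  moreover have "bij_betw (\<lambda>U\<in>restr (spart x) T. rank (bmap y T) ` bmap x U)
      (restr (spart x) T) (nc_restr (npart x) (bmap y T))"
  proof -
    have "bij_betw ((`) (rank (bmap y T)) \<circ> bmap x) (restr (spart x) T) (nc_restr (npart x) (bmap y T))"
      using bij_betw_trans[OF bij_betw_restr[OF T] inj_on_imp_bij_betw[OF inj_on_image_partition[OF p r]]]
      by (simp add: nc_restr_def part_map_def)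
    then show ?thesis by (auto cong: bij_betw_cong)
  qed
  moreover have "card (rank (bmap y T) ` bmap x U) = card U" if "U \<in> restr (spart x) T" for U
  proof -
    have U: "U \<in> spart x" "U \<subseteq> T" using that by (auto simp: restr_def)
    then have "card (rank (bmap y T) ` bmap x U) = card (bmap x U)"
      using r bmap_mono[OF T] by (intro card_image) (blast intro: inj_on_subset)
    then show ?thesis using NC2D(7)[OF x] U by simp
  qed
  ultimately show ?thesis by (simp add: NC2_iff psi_eq[OF T])
qed

end

section \<open>Chains of three elements\<close>

lemma NC2_le_trans:
  assumes "x \<in> NC2 S" "z \<in> NC2 S" "NC2_le S x y" "NC2_le S y z"
  shows "NC2_le S x z"
proof (rule NC2_leI[OF assms(1,2)])
  have xy: "refines S (spart y) (spart x)"
      "\<And>T U. T \<in> spart x \<Longrightarrow> U \<in> spart y \<Longrightarrow> U \<subseteq> T \<Longrightarrow> bmap y U \<subseteq> bmap x T"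
    and yz: "refines S (spart z) (spart y)"
      "\<And>T U. T \<in> spart y \<Longrightarrow> U \<in> spart z \<Longrightarrow> U \<subseteq> T \<Longrightarrow> bmap z U \<subseteq> bmap y T"
    using assms(3,4) by (simp_all add: NC2_le_iff)
  show "refines S (spart z) (spart x)" using refines_trans[OF yz(1) xy(1)] .
  fix T U assume TU: "T \<in> spart x" "U \<in> spart z" "U \<subseteq> T"
  \<comment> \<open>The intermediate block \<open>V\<close> around \<open>U\<close> meets
    \<open>T\<close>, so it lies in \<open>T\<close> and the two inclusions of images
    compose.\<close>
  obtain V where V: "V \<in> spart y" "U \<subseteq> V" using yz(1) TU by (auto simp: refines_def)
  obtain s where "s \<in> U" using partition_block_nonempty[OF NC2D(1)[OF assms(2)] TU(2)] by blast
  then have "V \<subseteq> T" using refines_block_subset[OF xy(1) V(1) TU(1)] TU V by blast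
  then show "bmap z U \<subseteq> bmap x T" using xy(2) yz(2) V TU by blast
qed

lemma NC2_interval_trans:
  "NC2_interval S x y \<Longrightarrow> NC2_interval S y z \<Longrightarrow> NC2_interval S x z"
  unfolding NC2_interval_def using NC2_le_trans by blast

text \<open>Monotonicity of \<phi> at \<open>x\<close>, in the form of a locale instance so that
  \<phi> and \<psi> can in turn be studied on the quotients.\<close>

lemma NC2_interval_phi:
  assumes "NC2_interval S z y" "NC2_interval S y x"
  shows "NC2_interval (blks (spart x)) (NC2_phi S x z) (NC2_phi S x y)"
proof -
  interpret zy: NC2_interval S z y by fact
  interpret yx: NC2_interval S y x by fact
  interpret zx: NC2_interval S z x using NC2_interval_trans assms .
  show ?thesis
  proof
    show "finite (blks (spart x))"
      using finite_elements[OF yx.fin NC2D(1)[OF yx.x]] by (simp add: blks_def)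
    show "NC2_le (blks (spart x)) (NC2_phi S x z) (NC2_phi S x y)"
    proof (rule NC2_leI[OF zx.phi_mem yx.phi_mem])
      show "refines (blks (spart x)) (spart (NC2_phi S x y)) (spart (NC2_phi S x z))"
        using refines_part_map[OF refines_part_quot[OF yx.ref zy.ref] yx.inj_obj]
        by (simp add: blks_def yx.spart_phi zx.spart_phi part_map_quot)
      fix Z Y assume "Z \<in> spart (NC2_phi S x z)" "Y \<in> spart (NC2_phi S x y)" "Y \<subseteq> Z"
      then obtain T U where T: "T \<in> spart z" "Z = obj ` restr (spart x) T"
        and U: "U \<in> spart y" "Y = obj ` restr (spart x) U"
        by (auto simp: yx.spart_phi zx.spart_phi)
      have "U \<subseteq> T" using quot_subset_iff[OF yx.ref zx.ref U(1) T(1) yx.inj_obj] T U \<open>Y \<subseteq> Z\<close> by simp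
      then have "bmap y U \<subseteq> bmap z T" using zy.bmap_mono T U by blast
      then have "restr (npart x) (bmap y U) \<subseteq> restr (npart x) (bmap z T)" by (auto simp: restr_def)
      then show "bmap (NC2_phi S x y) Y \<subseteq> bmap (NC2_phi S x z) Z"
        using T U yx.bmap_phi zx.bmap_phi by auto
    qed
  qed (rule zx.phi_mem yx.phi_mem)+
qed

text \<open>The counterpart for \<psi> at \<open>z\<close>, with the same double use: monotonicity
  in each factor, and access to \<phi> and \<psi> on the block \<open>T\<close>.\<close>

lemma NC2_interval_psi:
  assumes "NC2_interval S z y" "NC2_interval S y x" "T \<in> spart z"
  shows "NC2_interval T (NC2_psi S z y T) (NC2_psi S z x T)"
proof -
  interpret zy: NC2_interval S z y by fact
  interpret yx: NC2_interval S y x by fact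
  interpret zx: NC2_interval S z x using NC2_interval_trans assms(1,2) .
  show ?thesis
  proof
    show "finite T" using zy.fin NC2D(1)[OF zy.y] assms(3) by (metis finite_subset partition_block_subset)
    show "NC2_le T (NC2_psi S z y T) (NC2_psi S z x T)"
    proof (rule NC2_leI[OF zy.psi_mem[OF assms(3)] zx.psi_mem[OF assms(3)]])
      show "refines T (spart (NC2_psi S z x T)) (spart (NC2_psi S z y T))"
        using refines_restr[OF yx.ref zy.ref assms(3)]
        by (simp add: zx.psi_eq zy.psi_eq assms(3))
    qed (auto simp: zx.psi_eq zy.psi_eq assms(3) restr_def dest: yx.bmap_mono)
  qed (rule zy.psi_mem[OF assms(3)] zx.psi_mem[OF assms(3)])+
qed

section \<open>Functoriality\<close>

lemma spart_act: "spart (NC2_act S u x) = part_map u (spart x)"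
  and npart_act: "npart (NC2_act S u x) = npart x"
  by (cases x, simp add: NC2_act_def)+

text \<open>The action pulls a block back along \<open>inv_into S u\<close>, which undoes
  \<open>u\<close> on subsets of \<open>S\<close>.\<close>

lemma bmap_act:
  assumes "bij_betw u S S'" "x \<in> NC2 S" "T \<in> spart x"
  shows "bmap (NC2_act S u x) (u ` T) = bmap x T"
proof -
  have "inv_into S u ` u ` T = T"
    using assms partition_block_subset[OF NC2D(1)[OF assms(2)]]
    by (intro inv_into_image_cancel) (auto simp: bij_betw_def)
  moreover have "u ` T \<in> part_map u (spart x)" using assms by (auto simp: part_map_def)
  ultimately show ?thesis by (cases x) (simp add: NC2_act_def)
qed

lemma NC2_act_mem:
  assumes u: "bij_betw u S S'" and x: "x \<in> NC2 S"
  shows "NC2_act S u x \<in> NC2 S'"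
proof -
  note inj = bij_betw_imp_inj_on[OF u] and p = NC2D(1)[OF x]
  have "partition_on S' (part_map u (spart x))"
    using partition_on_part_map[OF p inj] u by (simp add: bij_betw_def)
  moreover have "card S = card S'" using u by (rule bij_betw_same_card)
  moreover have "bmap (NC2_act S u x) \<in> extensional (part_map u (spart x))"
    by (cases x) (simp add: NC2_act_def)
  moreover have "bij_betw (bmap (NC2_act S u x)) (part_map u (spart x)) (npart x)"
    unfolding part_map_def
  proof (rule bij_betw_imageI)
    show "inj_on (bmap (NC2_act S u x)) ((`) u ` spart x)"
    proof (rule inj_onI, clarify)
      fix T U assume TU: "T \<in> spart x" "U \<in> spart x"
        and "bmap (NC2_act S u x) (u ` T) = bmap (NC2_act S u x) (u ` U)"
      then have "bmap x T = bmap x U" by (simp add: bmap_act[OF u x])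
      then show "u ` T = u ` U" using inj_onD[OF bij_betw_imp_inj_on[OF NC2D(5)[OF x]]] TU by blast
    qed
    show "bmap (NC2_act S u x) ` (`) u ` spart x = npart x"
      unfolding image_image NC2D(6)[OF x, symmetric] by (intro image_cong refl bmap_act[OF u x])
  qed
  moreover have "card (bmap (NC2_act S u x) (u ` T)) = card (u ` T)" if "T \<in> spart x" for T
    using bmap_act[OF u x that] NC2D(7)[OF x that]
      card_image[OF inj_on_subset[OF inj partition_block_subset[OF p that]]] by simp
  ultimately show ?thesis
    using NC2D(2)[OF x] by (auto simp: NC2_iff spart_act npart_act part_map_def)
qed

lemma (in NC2_interval) NC2_interval_act:
  assumes u: "bij_betw u S S'"
  shows "NC2_interval S' (NC2_act S u y) (NC2_act S u x)"
proof
  show "finite S'" using fin bij_betw_finite[OF u] by simp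
  note inj = bij_betw_imp_inj_on[OF u]
  show "NC2_le S' (NC2_act S u y) (NC2_act S u x)"
  proof (rule NC2_leI[OF NC2_act_mem[OF u y] NC2_act_mem[OF u x]])
    show "refines S' (spart (NC2_act S u x)) (spart (NC2_act S u y))"
      using refines_part_map[OF ref inj] bij_betw_imp_surj_on[OF u] by (simp add: spart_act)
    fix Z Y assume "Z \<in> spart (NC2_act S u y)" "Y \<in> spart (NC2_act S u x)" and sub: "Y \<subseteq> Z"
    then obtain T U where T: "T \<in> spart y" "Z = u ` T" and U: "U \<in> spart x" "Y = u ` U"
      by (auto simp: spart_act part_map_def)
    have "U \<subseteq> T"
      using inj_on_image_subset_iff[OF inj partition_block_subset[OF NC2D(1)[OF x] U(1)]
          partition_block_subset[OF NC2D(1)[OF y] T(1)]] sub T U by simp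
    then show "bmap (NC2_act S u x) Y \<subseteq> bmap (NC2_act S u y) Z"
      using bmap_mono T U by (simp add: bmap_act[OF u x] bmap_act[OF u y])
  qed
qed (rule NC2_act_mem[OF u] x y)+

lemma NC2_act_cong:
  assumes u: "bij_betw u S S'" and uv: "\<And>s. s \<in> S \<Longrightarrow> u s = v s" and x: "x \<in> NC2 S"
  shows "NC2_act S u x = NC2_act S v x"
proof -
  have v: "bij_betw v S S'" using u uv bij_betw_cong by metis
  have im: "u ` T = v ` T" if "T \<in> spart x" for T
    using uv partition_block_subset[OF NC2D(1)[OF x] that] by (intro image_cong) auto
  show ?thesis
  proof (rule NC2_eqI[OF NC2_act_mem[OF u x] NC2_act_mem[OF v x]])
    show "spart (NC2_act S u x) = spart (NC2_act S v x)"
      using im by (auto simp: spart_act part_map_def)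
    fix Z assume "Z \<in> spart (NC2_act S u x)"
    then obtain T where "T \<in> spart x" "Z = u ` T" by (auto simp: spart_act part_map_def)
    then show "bmap (NC2_act S u x) Z = bmap (NC2_act S v x) Z"
      using bmap_act[OF u x] bmap_act[OF v x] im by metis
  qed
qed

lemma NC2_act_id:
  assumes x: "x \<in> NC2 S"
  shows "NC2_act S id x = x"
proof (rule NC2_eqI[OF NC2_act_mem[OF bij_betw_id x] x])
  show s: "spart (NC2_act S id x) = spart x" by (simp add: spart_act part_map_def)
  fix T assume "T \<in> spart (NC2_act S id x)"
  then show "bmap (NC2_act S id x) T = bmap x T" using bmap_act[OF bij_betw_id x, of T] s by simp
qed

lemma NC2_act_comp:
  assumes u: "bij_betw u S S'" and v: "bij_betw v S' S''" and x: "x \<in> NC2 S"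
  shows "NC2_act S (v \<circ> u) x = NC2_act S' v (NC2_act S u x)"
proof (rule NC2_eqI[OF NC2_act_mem[OF bij_betw_trans[OF u v] x] NC2_act_mem[OF v NC2_act_mem[OF u x]]])
  show "spart (NC2_act S (v \<circ> u) x) = spart (NC2_act S' v (NC2_act S u x))"
    by (simp add: spart_act part_map_def image_image image_comp)
  fix Z assume "Z \<in> spart (NC2_act S (v \<circ> u) x)"
  then obtain T where T: "T \<in> spart x" "Z = (v \<circ> u) ` T" by (auto simp: spart_act part_map_def)
  have uT: "u ` T \<in> spart (NC2_act S u x)" using T by (auto simp: spart_act part_map_def)
  show "bmap (NC2_act S (v \<circ> u) x) Z = bmap (NC2_act S' v (NC2_act S u x)) Z"
    using bmap_act[OF bij_betw_trans[OF u v] x T(1)] bmap_act[OF v NC2_act_mem[OF u x] uT]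
      bmap_act[OF u x T(1)] T(2) by (simp add: image_comp)
qed

section \<open>Finiteness and the poset species\<close>

lemma finite_NC2:
  assumes "finite S"
  shows "finite (NC2 S)"
proof (rule finite_subset)
  \<comment> \<open>The values of the maps are subsets of \<open>{1..card S}\<close>, so the triples
    lie in a dependent sum of finite sets.\<close>
  show "NC2 S \<subseteq> (SIGMA \<pi>:{\<pi>. partition_on S \<pi>}. {\<rho>. partition_on {1..card S} \<rho>} \<times>
      (\<Pi>\<^sub>E T\<in>\<pi>. Pow {1..card S}))"
  proof
    fix x :: "'a two_partition" assume x: "x \<in> NC2 S"
    have "bmap x T \<subseteq> {1..card S}" if "T \<in> spart x" for T
      using partition_block_subset[OF NC2D(3)[OF x] NC2D(8)[OF x that]] .
    then have "bmap x \<in> (\<Pi>\<^sub>E T\<in>spart x. Pow {1..card S})"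
      using NC2D(4)[OF x] by (auto simp: PiE_def)
    then show "x \<in> (SIGMA \<pi>:{\<pi>. partition_on S \<pi>}. {\<rho>. partition_on {1..card S} \<rho>} \<times>
        (\<Pi>\<^sub>E T\<in>\<pi>. Pow {1..card S}))"
      using NC2D(1,3)[OF x] by (cases x) simp
  qed
  show "finite (SIGMA \<pi>:{\<pi>. partition_on S \<pi>}. {\<rho>. partition_on {1..card S} \<rho>} \<times>
      (\<Pi>\<^sub>E T\<in>\<pi>. Pow {1..card S}))"
    using finitely_many_partition_on[OF assms] finitely_many_partition_on[of "{1..card S}"]
      finite_elements[OF assms]
    by (intro finite_SigmaI finite_cartesian_product finite_PiE) auto
qed

text \<open>Between blocks of one partition, inclusion is equality.\<close>

lemma NC2_le_refl: "x \<in> NC2 S \<Longrightarrow> NC2_le S x x"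
  by (rule NC2_leI) (blast intro: refines_refl NC2D(1) dest: partition_block_subset_eq[OF NC2D(1)])+

lemma NC2_le_antisym:
  assumes "x \<in> NC2 S" "y \<in> NC2 S" "NC2_le S x y" "NC2_le S y x"
  shows "x = y"
proof (rule NC2_eqI[OF assms(1,2)])
  show s: "spart x = spart y" using assms(3,4) refines_asym by (auto simp: NC2_le_iff)
  show "bmap x T = bmap y T" if "T \<in> spart x" for T
    using assms(3,4) that s unfolding NC2_le_iff by (metis order_refl subset_antisym)
qed

lemma poset_species_NC2: "poset_species (NC2 :: 'a hfs set \<Rightarrow> 'a two_partition set) NC2_le NC2_act"
proof
  fix S :: "'a hfs set" assume "fin_set S"
  then have S: "finite S" by (simp add: fin_set_def)
  show "finite (NC2 S)" using finite_NC2 S .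
  show "poset_on (NC2 S) (NC2_le S)"
    unfolding poset_on_def
    by (intro conjI reflp_onI antisymp_onI transp_onI)
      (blast intro: NC2_le_refl NC2_le_antisym NC2_le_trans)+
  fix S' and u :: "'a hfs \<Rightarrow> 'a hfs" assume u: "bij_betw u S S'"
  show "poset_morphism (NC2 S) (NC2_le S) (NC2 S') (NC2_le S') (NC2_act S u)"
    unfolding poset_morphism_def
  proof (intro conjI monotone_onI)
    show "NC2_act S u \<in> NC2 S \<rightarrow> NC2 S'" using NC2_act_mem[OF u] by blast
    fix x y assume "x \<in> NC2 S" "y \<in> NC2 S" "NC2_le S x y"
    then have "NC2_interval S x y" using S by unfold_locales
    then show "NC2_le S' (NC2_act S u x) (NC2_act S u y)"
      using NC2_interval.NC2_interval_act[OF _ u] NC2_interval.le by blast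
  qed
qed (rule NC2_act_cong NC2_act_id NC2_act_comp; assumption)+

section \<open>Equivariance and associativity\<close>

text \<open>Blocks are finite, so \<open>elts\<close> recovers them from \<open>obj\<close>, and
  \<open>induced u\<close> acts on \<open>obj U\<close> as \<open>u\<close> does on
  \<open>U\<close>.\<close>

lemma induced_quot:
  assumes "partition_on S \<pi>" "finite S" "inj_on u S" "T \<subseteq> S"
  shows "induced u ` obj ` restr \<pi> T = obj ` restr (part_map u \<pi>) (u ` T)"
proof -
  have "induced u (obj U) = obj (u ` U)" if "U \<in> restr \<pi> T" for U
    using that finite_subset[OF partition_block_subset[OF assms(1)] assms(2)]
    by (simp add: induced_def restr_def)
  then show ?thesis
    unfolding restr_part_map[OF assms(1,4,3)] unfolding part_map_def image_image by (intro image_cong) auto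
qed

lemma bij_betw_induced:
  assumes "partition_on S \<pi>" "finite S" "bij_betw u S S'"
  shows "bij_betw (induced u) (blks \<pi>) (blks (part_map u \<pi>))"
proof (rule bij_betw_imageI)
  have eq: "induced u (obj U) = obj (u ` U)" and fin: "finite (u ` U)" if "U \<in> \<pi>" for U
    using finite_subset[OF partition_block_subset[OF assms(1) that] assms(2)]
    by (simp_all add: induced_def)
  show "inj_on (induced u) (blks \<pi>)"
    unfolding blks_def
  proof (rule inj_onI, clarify)
    fix U V assume UV: "U \<in> \<pi>" "V \<in> \<pi>" "induced u (obj U) = induced u (obj V)"
    then have "u ` U = u ` V" using eq fin by (simp add: obj_eq_iff)
    then show "obj U = obj V"
      using inj_onD[OF inj_on_image_partition[OF assms(1) bij_betw_imp_inj_on[OF assms(3)]]] UV by blast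
  qed
  show "induced u ` blks \<pi> = blks (part_map u \<pi>)"
    unfolding blks_def part_map_def image_image using eq by (intro image_cong) auto
qed

text \<open>Transport leaves \<open>npart\<close> and the values of \<open>bmap\<close> unchanged,
  so the same \<open>block_rank\<close> occurs on both sides; only the encoded blocks have to be
  matched, by \<open>induced_quot\<close>.\<close>

lemma (in NC2_interval) equivariance_phi:
  assumes u: "bij_betw u S S'"
  shows "NC2_act (blks (spart x)) (induced u) (NC2_phi S x y)
    = NC2_phi S' (NC2_act S u x) (NC2_act S u y)"
proof -
  note ux = NC2D(1)[OF x] and inj = bij_betw_imp_inj_on[OF u]
  interpret u: NC2_interval S' "NC2_act S u y" "NC2_act S u x" using NC2_interval_act[OF u] .
  have ind: "bij_betw (induced u) (blks (spart x)) (blks (spart (NC2_act S u x)))"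
    unfolding spart_act using bij_betw_induced[OF ux fin u] .
  have im: "induced u ` obj ` restr (spart x) T = obj ` restr (spart (NC2_act S u x)) (u ` T)"
    if "T \<in> spart y" for T
    unfolding spart_act using induced_quot[OF ux fin inj partition_block_subset[OF NC2D(1)[OF y] that]] .
  show ?thesis
  proof (rule NC2_eqI[OF NC2_act_mem[OF ind phi_mem] u.phi_mem])
    show "spart (NC2_act (blks (spart x)) (induced u) (NC2_phi S x y))
      = spart (NC2_phi S' (NC2_act S u x) (NC2_act S u y))"
      unfolding u.spart_phi spart_act[of _ _ "NC2_phi S x y"] spart_phi
      using im by (simp add: part_map_def spart_act[of _ _ y] image_image)
    fix Z assume "Z \<in> spart (NC2_act (blks (spart x)) (induced u) (NC2_phi S x y))"
    then obtain T where T: "T \<in> spart y" "Z = induced u ` obj ` restr (spart x) T"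
      by (auto simp: spart_act spart_phi part_map_def)
    have "bmap (NC2_act (blks (spart x)) (induced u) (NC2_phi S x y)) Z
        = bmap (NC2_phi S x y) (obj ` restr (spart x) T)"
      unfolding T(2) using T(1) by (intro bmap_act[OF ind phi_mem]) (simp add: spart_phi)
    also have "\<dots> = block_rank (npart x) ` restr (npart x) (bmap y T)" by (rule bmap_phi[OF T(1)])
    also have "\<dots> = bmap (NC2_phi S' (NC2_act S u x) (NC2_act S u y)) Z"
      using u.bmap_phi[of "u ` T"] T(1) bmap_act[OF u y T(1)]
      unfolding T(2) im[OF T(1)] by (simp add: spart_act npart_act part_map_def)
    finally show "bmap (NC2_act (blks (spart x)) (induced u) (NC2_phi S x y)) Z
        = bmap (NC2_phi S' (NC2_act S u x) (NC2_act S u y)) Z" .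
  qed
qed

text \<open>The numerical data are again unchanged: on both sides the rank in
  \<open>bmap y T\<close> is applied to the same set \<open>bmap x U\<close>.\<close>

lemma (in NC2_interval) equivariance_psi:
  assumes u: "bij_betw u S S'" and T: "T \<in> spart y"
  shows "NC2_act T u (NC2_psi S y x T) = NC2_psi S' (NC2_act S u y) (NC2_act S u x) (u ` T)"
proof -
  note sub = partition_block_subset[OF NC2D(1)[OF y] T] and inj = bij_betw_imp_inj_on[OF u]
  interpret u: NC2_interval S' "NC2_act S u y" "NC2_act S u x" using NC2_interval_act[OF u] .
  have uT: "u ` T \<in> spart (NC2_act S u y)" using T by (simp add: spart_act part_map_def)
  have bij: "bij_betw u T (u ` T)" using bij_betw_subset[OF u sub refl] .
  have im: "restr (part_map u (spart x)) (u ` T) = part_map u (restr (spart x) T)"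
    using restr_part_map[OF NC2D(1)[OF x] sub inj] .
  show ?thesis
  proof (rule NC2_eqI[OF NC2_act_mem[OF bij psi_mem[OF T]] u.psi_mem[OF uT]])
    show "spart (NC2_act T u (NC2_psi S y x T)) = spart (NC2_psi S' (NC2_act S u y) (NC2_act S u x) (u ` T))"
      unfolding u.psi_eq(1)[OF uT] spart_act psi_eq(1)[OF T] im ..
    fix Z assume "Z \<in> spart (NC2_act T u (NC2_psi S y x T))"
    then obtain U where U: "U \<in> restr (spart x) T" "Z = u ` U"
      by (auto simp: spart_act part_map_def psi_eq[OF T])
    then have "U \<in> spart x" and Z: "Z \<in> restr (part_map u (spart x)) (u ` T)"
      by (auto simp: restr_def part_map_def)
    then show "bmap (NC2_act T u (NC2_psi S y x T)) Z
        = bmap (NC2_psi S' (NC2_act S u y) (NC2_act S u x) (u ` T)) Z"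
      using bmap_act[OF bij psi_mem[OF T], of U] U bmap_act[OF u x, of U] bmap_act[OF u y T]
      by (simp add: psi_eq[OF T] u.psi_eq[OF uT] spart_act)
  qed
qed

section \<open>Associativity\<close>

lemma associativity_phi:
  assumes "NC2_interval S z y" "NC2_interval S y x"
  shows "NC2_phi (blks (spart x)) (NC2_phi S x y) (NC2_phi S x z)
    = NC2_act (blks (spart y)) (identification (spart x)) (NC2_phi S y z)"
proof -
  interpret zy: NC2_interval S z y by fact
  interpret yx: NC2_interval S y x by fact
  interpret zx: NC2_interval S z x using NC2_interval_trans assms .
  interpret q: NC2_interval "blks (spart x)" "NC2_phi S x z" "NC2_phi S x y"
    using NC2_interval_phi assms .
  let ?h = "\<lambda>T. obj ` restr (spart x) T" and ?id = "identification (spart x)"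
  have id: "?id (obj T) = obj (?h T)" if "T \<in> spart y" for T
    using finite_subset[OF partition_block_subset[OF NC2D(1)[OF yx.y] that] zy.fin]
    by (simp add: identification_def blks_def)
  \<comment> \<open>The identification renames a block \<open>T\<close> of \<open>spart y\<close> as
    the quotient block formed by the blocks of \<open>spart x\<close> inside
    \<open>T\<close>.\<close>
  have bij: "bij_betw ?id (blks (spart y)) (blks (spart (NC2_phi S x y)))"
  proof (rule bij_betw_imageI)
    have fin: "finite (?h T)" for T
      using finite_elements[OF yx.fin NC2D(1)[OF yx.x]] by (simp add: restr_def)
    show "inj_on ?id (blks (spart y))"
      unfolding blks_def
    proof (rule inj_onI, clarify)
      fix T U assume TU: "T \<in> spart y" "U \<in> spart y" "?id (obj T) = ?id (obj U)"
      then have "?h T = ?h U" using id obj_eq_iff[OF fin fin] by simp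
      then show "obj T = obj U" using inj_onD[OF inj_on_quot[OF yx.ref yx.inj_obj]] TU by blast
    qed
    show "?id ` blks (spart y) = blks (spart (NC2_phi S x y))"
      unfolding blks_def yx.spart_phi image_image using id by (intro image_cong) auto
  qed
  have restr: "obj ` restr (spart (NC2_phi S x y)) (?h A) = ?id ` obj ` restr (spart y) A"
    if "A \<in> spart z" for A
  proof -
    have "restr (spart (NC2_phi S x y)) (?h A) = ?h ` restr (spart y) A"
      using restr_quot[OF yx.ref zx.ref that yx.inj_obj] by (simp add: yx.spart_phi part_map_quot)
    then show ?thesis
      unfolding image_image using id restr_subset by (simp add: image_image cong: image_cong_simp) (auto simp: restr_def id)
  qed
  show ?thesis
  proof (rule NC2_eqI[OF q.phi_mem NC2_act_mem[OF bij zy.phi_mem]])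
    show "spart (NC2_phi (blks (spart x)) (NC2_phi S x y) (NC2_phi S x z))
      = spart (NC2_act (blks (spart y)) ?id (NC2_phi S y z))"
      unfolding q.spart_phi spart_act zy.spart_phi zx.spart_phi part_map_def
        image_image[of "\<lambda>Z. obj ` restr (spart (NC2_phi S x y)) Z"] image_image[of "(`) ?id"]
      by (intro image_cong refl restr)
    fix Z assume "Z \<in> spart (NC2_phi (blks (spart x)) (NC2_phi S x y) (NC2_phi S x z))"
    then obtain A where A: "A \<in> spart z"
      and Z: "Z = obj ` restr (spart (NC2_phi S x y)) (?h A)"
      by (auto simp: q.spart_phi zx.spart_phi)
    have hA: "?h A \<in> spart (NC2_phi S x z)" using A by (simp add: zx.spart_phi)
    have C: "bmap z A \<in> npart z" using NC2D(8)[OF zx.y A] .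
    have "bmap (NC2_phi (blks (spart x)) (NC2_phi S x y) (NC2_phi S x z)) Z
      = block_rank (npart (NC2_phi S x y)) ` restr (npart (NC2_phi S x y)) (bmap (NC2_phi S x z) (?h A))"
      unfolding Z by (rule q.bmap_phi[OF hA])
    \<comment> \<open>The numerical side uses \<open>restr_quot\<close> as well, now with
      \<open>block_rank\<close> as the labelling.\<close>
    also have "restr (npart (NC2_phi S x y)) (bmap (NC2_phi S x z) (?h A))
      = (\<lambda>D. block_rank (npart x) ` restr (npart x) D) ` restr (npart y) (bmap z A)"
      unfolding zx.bmap_phi[OF A] yx.npart_phi nc_phi_def
      by (rule restr_quot[OF yx.ref_npart zx.ref_npart C yx.inj_block_rank])
    \<comment> \<open>Numbering the blocks of the quotient is numbering the blocks of
      \<open>npart y\<close> themselves.\<close>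
    also have "block_rank (npart (NC2_phi S x y)) ` \<dots> = block_rank (npart y) ` restr (npart y) (bmap z A)"
      unfolding image_image yx.npart_phi
      using block_rank_nc_phi[OF yx.ref_npart] by (intro image_cong) (auto simp: restr_def)
    also have "\<dots> = bmap (NC2_phi S y z) (obj ` restr (spart y) A)" by (rule zy.bmap_phi[OF A, symmetric])
    also have "\<dots> = bmap (NC2_act (blks (spart y)) ?id (NC2_phi S y z)) Z"
      unfolding Z restr[OF A] using A
      by (intro bmap_act[OF bij zy.phi_mem, symmetric]) (simp add: zy.spart_phi)
    finally show "bmap (NC2_phi (blks (spart x)) (NC2_phi S x y) (NC2_phi S x z)) Z
      = bmap (NC2_act (blks (spart y)) ?id (NC2_phi S y z)) Z" .
  qed
qed

lemma associativity_psi: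
  assumes "NC2_interval S z y" "NC2_interval S y x" and T: "T \<in> spart z" and U: "U \<in> restr (spart y) T"
  shows "NC2_psi T (NC2_psi S z y T) (NC2_psi S z x T) U = NC2_psi S y x U"
proof -
  interpret zy: NC2_interval S z y by fact
  interpret yx: NC2_interval S y x by fact
  interpret zx: NC2_interval S z x using NC2_interval_trans assms(1,2) .
  interpret r: NC2_interval T "NC2_psi S z y T" "NC2_psi S z x T"
    using NC2_interval_psi assms(1-3) .
  have U': "U \<in> spart (NC2_psi S z y T)" using U zy.psi_eq(1)[OF T] by simp
  have Uy: "U \<in> spart y" "U \<subseteq> T" using U by (auto simp: restr_def)
  have rr: "restr (restr (spart x) T) U = restr (spart x) U" using Uy(2) by (rule restr_restr)
  show ?thesis
  proof (rule NC2_eqI[OF r.psi_mem[OF U'] yx.psi_mem[OF Uy(1)]])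
    show "spart (NC2_psi T (NC2_psi S z y T) (NC2_psi S z x T) U) = spart (NC2_psi S y x U)"
      unfolding r.psi_eq[OF U'] zx.psi_eq[OF T] yx.psi_eq[OF Uy(1)] rr ..
    fix V assume "V \<in> spart (NC2_psi T (NC2_psi S z y T) (NC2_psi S z x T) U)"
    then have V: "V \<in> restr (spart x) U" "V \<in> restr (spart x) T" "V \<in> spart x" "V \<subseteq> U"
      unfolding r.psi_eq[OF U'] zx.psi_eq[OF T] rr using Uy(2) by (auto simp: restr_def)
    have "bmap x V \<subseteq> bmap y U" using yx.bmap_mono Uy V by blast
    \<comment> \<open>Ranking in \<open>bmap z T\<close> and then in the image of its subset
      \<open>bmap y U\<close> is ranking in \<open>bmap y U\<close> directly.\<close>
    then have "rank (rank (bmap z T) ` bmap y U) ` rank (bmap z T) ` bmap x V = rank (bmap y U) ` bmap x V"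
      unfolding image_image
      using rank_rank[OF finite_bmap[OF zy.y T] zy.bmap_mono[OF T Uy]] by (intro image_cong) auto
    then show "bmap (NC2_psi T (NC2_psi S z y T) (NC2_psi S z x T) U) V = bmap (NC2_psi S y x U) V"
      using V(1,2) U by (simp add: r.psi_eq[OF U'] zx.psi_eq[OF T] zy.psi_eq[OF T] yx.psi_eq[OF Uy(1)] rr)
  qed
qed

text \<open>On the left, the blocks of \<open>npart x\<close> are numbered and the numbers then
  compressed; on the right, the elements of \<open>bmap z T\<close> are compressed and the blocks
  then numbered. Both agree with numbering directly the blocks inside
  \<open>bmap z T\<close>.\<close>

lemma associativity_phi_psi:
  assumes "NC2_interval S z y" "NC2_interval S y x" and T: "T \<in> spart z"
  shows "NC2_psi (blks (spart x)) (NC2_phi S x z) (NC2_phi S x y) (blks (restr (spart x) T))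
    = NC2_phi T (NC2_psi S z x T) (NC2_psi S z y T)"
proof -
  interpret zy: NC2_interval S z y by fact
  interpret yx: NC2_interval S y x by fact
  interpret zx: NC2_interval S z x using NC2_interval_trans assms(1,2) .
  interpret q: NC2_interval "blks (spart x)" "NC2_phi S x z" "NC2_phi S x y"
    using NC2_interval_phi assms(1,2) .
  interpret r: NC2_interval T "NC2_psi S z y T" "NC2_psi S z x T"
    using NC2_interval_psi assms(1-3) .
  let ?h = "\<lambda>T. obj ` restr (spart x) T"
  let ?L = "NC2_psi (blks (spart x)) (NC2_phi S x z) (NC2_phi S x y) (blks (restr (spart x) T))"
  let ?R = "NC2_phi T (NC2_psi S z x T) (NC2_psi S z y T)"
  let ?A = "bmap z T"
  have hT: "blks (restr (spart x) T) \<in> spart (NC2_phi S x z)"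
    using T by (simp add: zx.spart_phi blks_def)
  have sL: "spart ?L = ?h ` restr (spart y) T"
    unfolding q.psi_eq[OF hT] unfolding blks_def yx.spart_phi
    using restr_quot[OF yx.ref zx.ref T yx.inj_obj] by (simp add: part_map_quot)
  have rr: "restr (restr (spart x) T) U = restr (spart x) U" if "U \<in> restr (spart y) T" for U
    using that by (intro restr_restr) (simp add: restr_def)
  have sR: "spart ?R = ?h ` restr (spart y) T"
    unfolding r.spart_phi zx.psi_eq[OF T] zy.psi_eq[OF T] using rr by (intro image_cong) auto
  have memR: "?R \<in> NC2 (blks (restr (spart x) T))" using r.phi_mem zx.psi_eq(1)[OF T] by simp
  show ?thesis
  proof (rule NC2_eqI[OF q.psi_mem[OF hT] memR])
    show "spart ?L = spart ?R" using sL sR by simp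
    fix Z assume "Z \<in> spart ?L"
    then obtain U where U: "U \<in> restr (spart y) T" "Z = ?h U" using sL by auto
    then have Uy: "U \<in> spart y" "U \<subseteq> T" by (auto simp: restr_def)
    let ?B = "bmap y U"
    have BA: "?B \<subseteq> ?A" using zy.bmap_mono[OF T Uy] .
    have finA: "finite ?A" using finite_bmap[OF zy.y T] .
    have sub: "restr (npart x) ?B \<subseteq> restr (npart x) ?A" using BA by (auto simp: restr_def)
    have Z: "Z \<in> restr (spart (NC2_phi S x y)) (blks (restr (spart x) T))"
      using \<open>Z \<in> spart ?L\<close> unfolding q.psi_eq[OF hT] .
    have "bmap ?L Z = rank (bmap (NC2_phi S x z) (blks (restr (spart x) T))) ` bmap (NC2_phi S x y) Z"
      using Z by (simp add: q.psi_eq[OF hT])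
    also have "\<dots> = rank (block_rank (npart x) ` restr (npart x) ?A) `
        block_rank (npart x) ` restr (npart x) ?B"
      unfolding blks_def U(2) zx.bmap_phi[OF T] yx.bmap_phi[OF Uy(1)] ..
    also have "\<dots> = block_rank (restr (npart x) ?A) ` restr (npart x) ?B"
      unfolding image_image
      using rank_block_rank[OF NC2D(3)[OF yx.x] _ restr_subset] sub by (intro image_cong) auto
    also have "\<dots> = block_rank (nc_restr (npart x) ?A) ` (`) (rank ?A) ` restr (npart x) ?B"
      unfolding image_image
      using block_rank_nc_restr[OF zx.partition_on_restr_npart[OF T] finA] sub by (intro image_cong) auto
    \<comment> \<open>The relabelled blocks are rewritten as a restriction of the numerical
      partition of \<psi>, the form in which \<open>bmap_phi\<close> applies.\<close>
    also have "(`) (rank ?A) ` restr (npart x) ?B = restr (nc_restr (npart x) ?A) (rank ?A ` ?B)"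
      using restr_part_map[OF zx.partition_on_restr_npart[OF T] BA inj_on_rank[OF finA]]
      by (simp add: nc_restr_def part_map_def restr_restr[OF BA])
    also have "block_rank (nc_restr (npart x) ?A) ` \<dots>
        = bmap ?R (obj ` restr (spart (NC2_psi S z x T)) U)"
      using r.bmap_phi[of U] U(1) by (simp add: zx.psi_eq[OF T] zy.psi_eq[OF T])
    also have "obj ` restr (spart (NC2_psi S z x T)) U = Z"
      using rr[OF U(1)] U(2) by (simp add: zx.psi_eq[OF T])
    finally show "bmap ?L Z = bmap ?R Z" .
  qed
qed

section \<open>Minimal and maximal elements\<close>

lemma min_elements_least:
  assumes "poset_on A le" "b \<in> A" "\<And>x. x \<in> A \<Longrightarrow> le b x"
  shows "min_elements A le = {b}"
  using assms by (auto simp: min_elements_def poset_on_def antisymp_on_def)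

lemma max_elements_greatest:
  assumes "poset_on A le" "t \<in> A" "\<And>x. x \<in> A \<Longrightarrow> le x t"
  shows "max_elements A le = {t}"
  using assms by (auto simp: max_elements_def poset_on_def antisymp_on_def)

lemma poset_on_Part: "poset_on (Part S) (part_le S)"
  unfolding poset_on_def
proof (intro conjI reflp_onI antisymp_onI transp_onI)
  show "part_le S \<pi> \<pi>" if "\<pi> \<in> Part S" for \<pi>
    using that by (simp add: Part_def part_le_def refines_refl)
  show "\<pi> = \<rho>" if "part_le S \<pi> \<rho>" "part_le S \<rho> \<pi>" for \<pi> \<rho>
    using that unfolding part_le_def by (rule refines_asym[rotated])
  show "part_le S \<pi> \<sigma>" if "part_le S \<pi> \<rho>" "part_le S \<rho> \<sigma>" for \<pi> \<rho> \<sigma>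
    using that refines_trans unfolding part_le_def by blast
qed

lemma refines_one_block:
  assumes "S \<noteq> {}" "partition_on S \<pi>"
  shows "refines S \<pi> {S}"
  using assms partition_on_space[of S] by (auto simp: refines_def dest: partition_block_subset)

lemma singletons_refine:
  assumes "partition_on S \<pi>"
  shows "refines S ((\<lambda>s. {s}) ` S) \<pi>"
  using assms partition_on_singletons[of S] by (auto simp: refines_def partition_on_def)

lemma min_elements_Part: "S \<noteq> {} \<Longrightarrow> min_elements (Part S) (part_le S) = {{S}}"
  by (rule min_elements_least[OF poset_on_Part])
    (simp_all add: Part_def part_le_def refines_one_block partition_on_space)

lemma max_elements_Part: "max_elements (Part S) (part_le S) = {(\<lambda>s. {s}) ` S}"
  by (rule max_elements_greatest[OF poset_on_Part])
    (simp_all add: Part_def part_le_def singletons_refine partition_on_singletons)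

lemma bmap_one_block:
  assumes "x \<in> NC2 S" "spart x = {S}"
  shows "bmap x S = {1..card S}"
proof -
  have "npart x = {bmap x S}" using NC2D(6)[OF assms(1)] assms(2) by simp
  then show ?thesis using partition_onD1[OF NC2D(3)[OF assms(1)]] by simp
qed

lemma poset_on_NC2: "fin_set S \<Longrightarrow> poset_on (NC2 S) (NC2_le S)"
  by (rule poset_species.poset_P[OF poset_species_NC2])

text \<open>Over the one-block partition the map must send \<open>S\<close> to the whole interval,
  so a single element \<open>b\<close> lies there, and \<open>b\<close> is the least
  element.\<close>

lemma min_elements_NC2:
  assumes "fin_set S"
  shows "\<exists>b. {x \<in> NC2 S. spart x = {S}} = {b} \<and> min_elements (NC2 S) (NC2_le S) = {b}"
proof -
  have S: "finite S" "S \<noteq> {}" using assms by (auto simp: fin_set_def)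
  let ?N = "{1..card S}"
  define b where "b = ({S}, {?N}, \<lambda>T\<in>{S}. ?N)"
  have "?N \<noteq> {}" using S by (simp add: Suc_le_eq card_gt_0_iff)
  then have N: "partition_on ?N {?N}" by (rule partition_on_space)
  have b: "b \<in> NC2 S" "spart b = {S}"
    using partition_on_space[OF S(2)] N
    by (auto simp: b_def NC2_iff bij_betw_def intro!: noncrossingI)
  have least: "NC2_le S b x" if x: "x \<in> NC2 S" for x
  proof (rule NC2_leI[OF b(1) x])
    show "refines S (spart x) (spart b)" using refines_one_block[OF S(2) NC2D(1)[OF x]] b(2) by simp
    show "bmap x U \<subseteq> bmap b T" if "T \<in> spart b" "U \<in> spart x" for T U
      using partition_block_subset[OF NC2D(3)[OF x] NC2D(8)[OF x that(2)]] that(1)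
      by (simp add: b_def)
  qed
  have "x = b" if "x \<in> NC2 S" "spart x = {S}" for x
    using bmap_one_block[OF that] bmap_one_block[OF b] that b(2)
    by (intro NC2_eqI[OF that(1) b(1)]) auto
  then have "{x \<in> NC2 S. spart x = {S}} = {b}" using b by blast
  then show ?thesis
    using min_elements_least[OF poset_on_NC2[OF assms] b(1) least] by blast
qed

text \<open>Any choice of bijections \<open>T \<rightarrow> f(T)\<close> splits all blocks into singletons.\<close>

lemma NC2_le_discrete:
  assumes x: "x \<in> NC2 S" and S: "finite S"
  shows "\<exists>y\<in>NC2 S. spart y = (\<lambda>s. {s}) ` S \<and> NC2_le S x y"
proof -
  note p = NC2D(1)[OF x]
  have "\<exists>h. bij_betw h T (bmap x T)" if "T \<in> spart x" for T
    using that NC2D(7)[OF x that] finite_bmap[OF x that] finite_subset[OF partition_block_subset[OF p that] S]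
    by (intro finite_same_card_bij) simp_all
  then obtain H where H: "\<And>T. T \<in> spart x \<Longrightarrow> bij_betw (H T) T (bmap x T)" by metis
  have "\<exists>T. T \<in> spart x \<and> s \<in> T" if "s \<in> S" for s
    using that partition_onD1[OF p] by blast
  then obtain B where B: "\<And>s. s \<in> S \<Longrightarrow> B s \<in> spart x \<and> s \<in> B s" by metis
  \<comment> \<open>The bijections on the blocks are glued to one map \<open>k\<close> on
    \<open>S\<close>, evaluated through the block \<open>B s\<close> of \<open>s\<close>.\<close>
  define k where "k s = H (B s) s" for s
  have kT: "k ` T = bmap x T" if T: "T \<in> spart x" for T
  proof -
    have "B s = T" if "s \<in> T" for s
      using B[of s] that partition_block_subset[OF p T] partition_block_eq[OF p _ T] by blast
    then have "k ` T = H T ` T" by (intro image_cong) (simp_all add: k_def)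
    then show ?thesis using H[OF T] by (simp add: bij_betw_def)
  qed
  have "k ` S = \<Union>((`) k ` spart x)" using partition_onD1[OF p] by blast
  also have "\<dots> = \<Union>(npart x)" using kT NC2D(6)[OF x] by auto
  finally have im: "k ` S = {1..card S}" using partition_onD1[OF NC2D(3)[OF x]] by simp
  \<comment> \<open>A surjection between finite sets of equal cardinality is injective.\<close>
  then have inj: "inj_on k S" using S by (intro eq_card_imp_inj_on) simp_all
  let ?D = "\<lambda>A. (\<lambda>s. {s}) ` A"
  \<comment> \<open>The witness sends the block \<open>{s}\<close> to \<open>{k s}\<close>.\<close>
  define y where "y = (?D S, ?D {1..card S}, \<lambda>U\<in>?D S. k ` U)"
  have "bij_betw ((`) k) (?D S) (?D {1..card S})"
  proof (rule bij_betw_imageI)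
    show "inj_on ((`) k) (?D S)" using inj_on_image_partition[OF partition_on_singletons inj] .
    show "(`) k ` ?D S = ?D {1..card S}" unfolding im[symmetric] by (simp add: image_image)
  qed
  then have "bij_betw (\<lambda>U\<in>?D S. k ` U) (?D S) (?D {1..card S})" by simp
  moreover have "noncrossing (card S) (?D {1..card S})"
    using partition_on_singletons by (rule noncrossingI) auto
  ultimately have y: "y \<in> NC2 S"
    using partition_on_singletons[of S] by (simp add: y_def NC2_iff)
  have "NC2_le S x y"
  proof (rule NC2_leI[OF x y])
    show "refines S (spart y) (spart x)" using singletons_refine[OF p] by (simp add: y_def)
    fix T U assume "T \<in> spart x" "U \<in> spart y" "U \<subseteq> T"
    then show "bmap y U \<subseteq> bmap x T" using kT[of T] by (auto simp: y_def)
  qed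
  moreover have "spart y = ?D S" by (simp add: y_def)
  ultimately show ?thesis using y by blast
qed

text \<open>Above an element over the discrete partition, the set partition cannot change and the
  maps agree, since an inclusion of finite sets of equal cardinality is an equality. Conversely, a
  maximal element equals the discrete one above it given by \<open>NC2_le_discrete\<close>. Maximal
  elements may be numerous, one for each bijection from \<open>S\<close> to
  \<open>{1..card S}\<close>.\<close>

lemma max_elements_NC2:
  assumes "fin_set S"
  shows "{x \<in> NC2 S. spart x = (\<lambda>s. {s}) ` S} = max_elements (NC2 S) (NC2_le S)"
proof (intro set_eqI iffI)
  fix x :: "'a two_partition"
  assume "x \<in> {x \<in> NC2 S. spart x = (\<lambda>s. {s}) ` S}"
  then have x: "x \<in> NC2 S" and sx: "spart x = (\<lambda>s. {s}) ` S" by auto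
  have "y = x" if y: "y \<in> NC2 S" and le: "NC2_le S x y" for y
  proof (rule NC2_eqI[OF y x])
    have "refines S (spart y) (spart x)" using le by (simp add: NC2_le_iff)
    then show s: "spart y = spart x"
      using singletons_refine[OF NC2D(1)[OF y]] refines_asym sx by metis
    show "bmap y T = bmap x T" if "T \<in> spart y" for T
    proof (rule card_subset_eq)
      show "finite (bmap x T)" using finite_bmap[OF x] s that by simp
      show "bmap y T \<subseteq> bmap x T" using le that s by (auto simp: NC2_le_iff)
      show "card (bmap y T) = card (bmap x T)" using NC2D(7)[OF x] NC2D(7)[OF y] s that by simp
    qed
  qed
  then show "x \<in> max_elements (NC2 S) (NC2_le S)" using x by (simp add: max_elements_def)
next
  fix x :: "'a two_partition"
  assume x: "x \<in> max_elements (NC2 S) (NC2_le S)"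
  then have xS: "x \<in> NC2 S" by (simp add: max_elements_def)
  obtain y where y: "y \<in> NC2 S" "spart y = (\<lambda>s. {s}) ` S" "NC2_le S x y"
    using NC2_le_discrete[OF xS] assms unfolding fin_set_def by blast
  then have "y = x" using x by (simp add: max_elements_def)
  then show "x \<in> {x \<in> NC2 S. spart x = (\<lambda>s. {s}) ` S}" using y by simp
qed

text \<open>The only partition of \<open>{s}\<close> is its one-block partition, so the whole set is
  the fibre described by \<open>min_elements_NC2\<close>.\<close>

lemma is_singleton_NC2: "is_singleton (NC2 {s})"
proof -
  have "spart x = {{s}}" if "x \<in> NC2 {s}" for x
    using refines_asym[of "{s}" "spart x" "{{s}}"] singletons_refine[OF NC2D(1)[OF that]]
      refines_one_block[OF _ NC2D(1)[OF that]] by simp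
  then have "NC2 {s} = {x \<in> NC2 {s}. spart x = {{s}}}" by blast
  then show ?thesis
    using min_elements_NC2[of "{s}"] by (auto simp: fin_set_def is_singleton_def)
qed

section \<open>Verification of the axioms\<close>

interpretation NC2: poset_species NC2 NC2_le NC2_act
  by (rule poset_species_NC2)

lemma NC2_interval_down:
  assumes "fin_set S" "x \<in> NC2 S" "y \<in> NC2.down S x"
  shows "NC2_interval S y x"
  using assms by unfold_locales (auto simp: fin_set_def NC2.down_def)

lemma NC2_interval_up:
  assumes "fin_set S" "x \<in> NC2 S" "y \<in> NC2.up S x"
  shows "NC2_interval S x y"
  using assms by unfold_locales (auto simp: fin_set_def NC2.up_def)

lemma NC2_a_eq: "NC2_a S x = spart x"
  by (cases x) (simp add: NC2_a_def)

theorem proposition5p7: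
  shows "operadic_poset_species (NC2 :: 'a hfs set \<Rightarrow> 'a two_partition set)
    NC2_le NC2_act NC2_a NC2_phi NC2_psi"
proof (intro operadic_poset_species.intro poset_species_NC2 operadic_poset_species_axioms.intro)
  fix S :: "'a hfs set" assume S: "fin_set S"
  then have fin: "finite S" and ne: "S \<noteq> {}" by (simp_all add: fin_set_def)
  show "poset_morphism (NC2 S) (NC2_le S) (Part S) (part_le S) (NC2_a S)"
    by (auto simp: poset_morphism_def NC2_a_eq Part_def NC2D(1) NC2_le_iff part_le_def
        intro!: monotone_onI)
  show "{x \<in> NC2 S. NC2_a S x \<in> min_elements (Part S) (part_le S)} = min_elements (NC2 S) (NC2_le S)"
    using min_elements_NC2[OF S] unfolding NC2_a_eq min_elements_Part[OF ne] by auto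
  show "{x \<in> NC2 S. NC2_a S x \<in> max_elements (Part S) (part_le S)} = max_elements (NC2 S) (NC2_le S)"
    using max_elements_NC2[OF S] unfolding NC2_a_eq max_elements_Part by simp
  fix x :: "'a two_partition" assume x: "x \<in> NC2 S"
  {
    fix \<pi> assume \<pi>: "\<pi> = NC2_a S x"
    show "poset_morphism (NC2.down S x) (NC2_le S) (NC2 (blks \<pi>)) (NC2_le (blks \<pi>)) (NC2_phi S x)"
      unfolding poset_morphism_def \<pi> NC2_a_eq
    proof (intro conjI monotone_onI funcsetI)
      fix y assume y: "y \<in> NC2.down S x"
      note I = NC2_interval_down[OF S x y]
      show "NC2_phi S x y \<in> NC2 (blks (spart x))" by (rule NC2_interval.phi_mem[OF I])
      fix z assume "z \<in> NC2.down S x" "NC2_le S z y"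
      then have "NC2_interval S z y" using y fin by unfold_locales (auto simp: NC2.down_def)
      then show "NC2_le (blks (spart x)) (NC2_phi S x z) (NC2_phi S x y)"
        using NC2_interval.le[OF NC2_interval_phi[OF _ I]] by blast
    qed
    show "poset_morphism (NC2.up S x) (NC2_le S) (NC2.prod_P \<pi>) (NC2.prod_le \<pi>) (NC2_psi S x)"
      unfolding poset_morphism_def \<pi> NC2_a_eq
    proof (intro conjI monotone_onI funcsetI)
      fix y assume y: "y \<in> NC2.up S x"
      note I = NC2_interval_up[OF S x y]
      \<comment> \<open>The product \<open>prod_P\<close> is extensional, so values outside the
        blocks have to be \<open>undefined\<close>; the restricted lambda in \<open>NC2_psi\<close>
        provides this.\<close>
      have "NC2_psi S x y \<in> extensional (spart x)"
        by (cases x; cases y) (simp add: NC2_psi_def)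
      then show "NC2_psi S x y \<in> NC2.prod_P (spart x)"
        using NC2_interval.psi_mem[OF I] by (auto simp: NC2.prod_P_def PiE_def)
      fix z assume "z \<in> NC2.up S x" "NC2_le S y z"
      then have "NC2_interval S y z" using y fin by unfold_locales (auto simp: NC2.up_def)
      then show "NC2.prod_le (spart x) (NC2_psi S x y) (NC2_psi S x z)"
        using NC2_interval.le[OF NC2_interval_psi[OF I]] by (simp add: NC2.prod_le_def)
    qed
    show "NC2_a (blks \<pi>) (NC2_phi S x y) = part_phi \<pi> (NC2_a S y)" if "y \<in> NC2.down S x" for y
      using NC2_interval.spart_phi[OF NC2_interval_down[OF S x that]]
      by (simp add: \<pi> NC2_a_eq part_phi_def part_map_quot)
    show "NC2_a T (NC2_psi S x y T) = part_psi \<pi> (NC2_a S y) T" if "y \<in> NC2.up S x" "T \<in> \<pi>" for y T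
      using NC2_interval.psi_eq(1)[OF NC2_interval_up[OF S x that(1)]] that(2)
      by (simp add: \<pi> NC2_a_eq part_psi_def)
  }
  {
    fix u :: "'a hfs \<Rightarrow> 'a hfs" and S' assume u: "bij_betw u S S'"
    show "NC2_a S' (NC2_act S u x) = part_map u (NC2_a S x)"
      by (simp add: NC2_a_eq spart_act)
    fix x' \<pi> assume x': "x' = NC2_act S u x" and \<pi>: "\<pi> = NC2_a S x"
    show "NC2_act (blks \<pi>) (induced u) (NC2_phi S x y) = NC2_phi S' x' (NC2_act S u y)"
      if "y \<in> NC2.down S x" for y
      unfolding x' \<pi> NC2_a_eq using NC2_interval.equivariance_phi[OF NC2_interval_down[OF S x that] u] .
    show "NC2_act T u (NC2_psi S x y T) = NC2_psi S' x' (NC2_act S u y) (u ` T)"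
      if "y \<in> NC2.up S x" "T \<in> \<pi>" for y T
      using NC2_interval.equivariance_psi[OF NC2_interval_up[OF S x that(1)] u] that(2)
      by (simp add: x' \<pi> NC2_a_eq)
  }
  fix x' \<pi> \<pi>' assume x': "x' \<in> NC2 S" and "NC2_le S x x'"
    and \<pi>: "\<pi> = NC2_a S x" and \<pi>': "\<pi>' = NC2_a S x'"
  then have I: "NC2_interval S x x'" using fin x by unfold_locales
  \<comment> \<open>The associativity lemmas concern a chain of three elements; \<open>y\<close> is
    its bottom, top and middle element in the three goals below, in this order.\<close>
  fix y
  show "NC2_phi (blks \<pi>') (NC2_phi S x' x) (NC2_phi S x' y)
      = NC2_act (blks \<pi>) (identification \<pi>') (NC2_phi S x y)" if "y \<in> NC2.down S x"
    unfolding \<pi> \<pi>' NC2_a_eq using associativity_phi[OF NC2_interval_down[OF S x that] I] .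
  show "NC2_psi T (NC2_psi S x x' T) (NC2_psi S x y T) U = NC2_psi S x' y U"
    if "y \<in> NC2.up S x'" "T \<in> \<pi>" "U \<in> restr \<pi>' T" for T U
    using that(2,3) unfolding \<pi> \<pi>' NC2_a_eq
    by (rule associativity_psi[OF I NC2_interval_up[OF S x' that(1)]])
  show "NC2_psi (blks \<pi>') (NC2_phi S x' x) (NC2_phi S x' y) (blks (restr \<pi>' T))
      = NC2_phi T (NC2_psi S x x' T) (NC2_psi S x y T)"
    if y: "y \<in> NC2.up S x \<inter> NC2.down S x'" and T: "T \<in> \<pi>" for T
  proof -
    have "NC2_interval S x y" "NC2_interval S y x'"
      using NC2_interval_up[OF S x] NC2_interval_down[OF S x'] y by auto
    then show ?thesis using associativity_phi_psi T unfolding \<pi> \<pi>' NC2_a_eq by blast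
  qed
qed (rule is_singleton_NC2)

end
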